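(* Let $X$ be a topological space, let $\nu$ be an atomless Borel probability measure on $X$, and let $G$ be a locally compact Hausdorff unimodular group acting continuously on $X$ and preserving $\nu$. Assume that the corresponding Koopman representation $\pi_0$ of $G$ on $L^2_0(X,\nu)$ is strongly continuous. Suppose there exists a point $x_0$ in the support of $\nu$ such that $\nu(Kx_0)=0$ for every compact subset $K$ of $G$, and such that the stabilizer $G_{x_0}=\mathrm{Stab}_G(x_0)$ is compact. Then any finite positive regular Borel measure $\mu$ on $G$ satisfies $\|\pi_0(\mu)\|\geq\|\lambda_G(\mu)\|$.
   Context: A measure space $(X,\nu)$ is atomless if it has no atom, an atom being a measurable set $A$ with $\nu(A)>0$ such that every measurable $B\subset A$ has $\nu(B)\in\{0,\nu(A)\}$. A continuous action means that the map $G\times X\to X$ defining it is continuous. For a measure-preserving action of $G$ on a probability space $(X,\nu)$, $L^2_0(X,\nu)$ is the subspace of $L^2(X,\nu)$ of functions of zero integral, and the Koopman representation $\pi_0:G\to U(L^2_0(X,\nu))$ is $(\pi_0(g)\phi)(x)=\phi(g^{-1}x)$. The left regular representation $\lambda_G$ of $G$ on $L^2(G,\mu_G)$ ($\mu_G$ a left Haar measure) is $(\lambda_G(g)\phi)(h)=\phi(g^{-1}h)$. For a strongly continuous unitary representation $\pi$ of $G$ on a Hilbert space $\mathcal{H}$ and a finite regular Borel measure $\mu$ on $G$, $\pi(\mu)$ is the unique bounded operator on $\mathcal{H}$ with $\langle\pi(\mu)\xi,\eta\rangle=\int_G\langle\pi(g)\xi,\eta\rangle\,\mathrm{d}\mu(g)$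 for all $\xi,\eta\in\mathcal{H}$; $\|\cdot\|$ is the operator norm.
   Formalization: The condition ν(Kx₀)=0 is read as: Kx₀ lies in open sets of arbitrarily small ν-measure (equivalent for outer regular ν); with mere nullness the claim fails, e.g. for the circle plus a null fixed point whose only neighbourhood is X. *)

theory Defs
  imports "HOL-Probability.Probability"
begin

text \<open>
  Groups are written additively, because the type classes of topological groups are: the class
  \<^class>\<open>topological_group_add\<close> does not assume commutativity, so that \<open>g + h\<close> is the product
  \<open>gh\<close>, \<open>- g\<close> is the inverse of \<open>g\<close>, and \<open>0\<close> is the identity element.
\<close>


section \<open>Measures on topological spaces and groups\<close>

definition atomless :: "'a measure \<Rightarrow> bool" where
  "atomless M \<longleftrightarrow>
     \<not> (\<exists>A\<in>sets M. emeasure M A > 0 \<and>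
          (\<forall>B\<in>sets M. B \<subseteq> A \<longrightarrow> emeasure M B = 0 \<or> emeasure M B = emeasure M A))"

definition measure_support :: "'a::topological_space measure \<Rightarrow> 'a set" where
  "measure_support M = {x. \<forall>U. open U \<and> x \<in> U \<longrightarrow> emeasure M U > 0}"

definition outer_regular_on :: "'a::topological_space set set \<Rightarrow> 'a measure \<Rightarrow> bool" where
  "outer_regular_on \<A> M \<longleftrightarrow>
     (\<forall>A\<in>\<A>. emeasure M A = (INF V\<in>{V. open V \<and> A \<subseteq> V}. emeasure M V))"

definition inner_regular_on :: "'a::topological_space set set \<Rightarrow> 'a measure \<Rightarrow> bool" where
  "inner_regular_on \<A> M \<longleftrightarrow>
     (\<forall>A\<in>\<A>. emeasure M A = (SUP K\<in>{K. compact K \<and> K \<subseteq> A}. emeasure M K))"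

definition finite_regular_borel_measure :: "'a::t2_space measure \<Rightarrow> bool" where
  "finite_regular_borel_measure M \<longleftrightarrow>
     sets M = sets borel \<and> finite_measure M \<and>
     outer_regular_on (sets borel) M \<and> inner_regular_on (sets borel) M"

text \<open>
  Left Haar measures are Radon measures in the usual sense for groups that need not be
  \<open>\<sigma>\<close>-compact: inner regularity is only required on open sets.
\<close>

definition left_haar_measure :: "'g::{topological_group_add,t2_space} measure \<Rightarrow> bool" where
  "left_haar_measure M \<longleftrightarrow>
     sets M = sets borel \<and> emeasure M UNIV \<noteq> 0 \<and>
     (\<forall>K. compact K \<longrightarrow> emeasure M K < \<infinity>) \<and>
     outer_regular_on (sets borel) M \<and> inner_regular_on {U. open U} M \<and>
     (\<forall>g. \<forall>A\<in>sets borel. emeasure M ((\<lambda>h. g + h) ` A) = emeasure M A)"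

definition unimodular :: "'g::{topological_group_add,t2_space} itself \<Rightarrow> bool" where
  "unimodular _ \<longleftrightarrow>
     (\<forall>M::'g measure. left_haar_measure M \<longrightarrow>
        (\<forall>g. \<forall>A\<in>sets borel. emeasure M ((\<lambda>h. h + g) ` A) = emeasure M A))"

text \<open>
  The measure of an arbitrary subset of a topological space. The image \<open>K x\<^sub>0\<close> of a compact set
  under a continuous map is compact, but need not be a Borel set when the space is not Hausdorff,
  so that \<open>\<nu>(K x\<^sub>0)\<close> has to be given a meaning. It is the infimum of \<open>\<nu>(V)\<close> over the open sets
  \<open>V\<close> containing \<open>K x\<^sub>0\<close>. If \<open>\<nu>\<close> is outer regular (for example, any finite Borel measure on a
  metrizable space), this vanishes precisely for the subsets of \<open>\<nu>\<close>-null Borel sets, see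
  \<open>open_outer_measure_eq_0_iff\<close> below. For measures that are not outer regular it may be positive
  on a Borel set that is \<open>\<nu>\<close>-null, and there mere nullness of \<open>K x\<^sub>0\<close> does not suffice for the
  inequality between the operator norms: add to the circle group \<open>G\<close> with its normalized Haar
  measure \<open>\<nu>\<close> a \<open>\<nu>\<close>-null fixed point \<open>x\<^sub>0\<close> whose only neighbourhood is the whole space, and
  let \<open>\<mu> = \<nu>\<close>. Then \<open>\<pi>\<^sub>0(\<mu>) = 0\<close>, while \<open>\<lambda>\<^sub>G(\<mu>)\<close> is the projection onto the constants.
\<close>

definition open_outer_measure :: "'a::topological_space measure \<Rightarrow> 'a set \<Rightarrow> ennreal" where
  "open_outer_measure M A = (INF V\<in>{V. open V \<and> A \<subseteq> V}. emeasure M V)"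

lemma open_outer_measure_eq_emeasure:
  assumes "outer_regular_on (sets borel) M" "A \<in> sets borel"
  shows "open_outer_measure M A = emeasure M A"
  using assms by (simp add: outer_regular_on_def open_outer_measure_def)

lemma open_outer_measure_mono: "A \<subseteq> B \<Longrightarrow> open_outer_measure M A \<le> open_outer_measure M B"
  unfolding open_outer_measure_def by (intro INF_superset_mono) auto

lemma open_outer_measure_eq_0_iff:
  assumes sets: "sets M = sets borel" and reg: "outer_regular_on (sets borel) M"
  shows "open_outer_measure M A = 0 \<longleftrightarrow> (\<exists>N\<in>null_sets M. A \<subseteq> N)"
proof
  assume "\<exists>N\<in>null_sets M. A \<subseteq> N"
  then obtain N where N: "N \<in> null_sets M" "A \<subseteq> N"
    by blast
  then have "open_outer_measure M N = 0"
    using open_outer_measure_eq_emeasure[OF reg] sets by (auto simp: null_sets_def)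
  then show "open_outer_measure M A = 0"
    using open_outer_measure_mono[OF N(2), of M] by simp
next
  assume zero: "open_outer_measure M A = 0"
  have "\<exists>V. open V \<and> A \<subseteq> V \<and> emeasure M V < ennreal (1 / Suc n)" for n
  proof -
    have "(INF V\<in>{V. open V \<and> A \<subseteq> V}. emeasure M V) < ennreal (1 / Suc n)"
      using zero by (simp add: open_outer_measure_def)
    then show ?thesis
      unfolding INF_less_iff by blast
  qed
  then obtain V where V: "\<And>n. open (V n)" "\<And>n. A \<subseteq> V n"
      "\<And>n::nat. emeasure M (V n) < ennreal (1 / Suc n)"
    by metis
  define N where "N = (\<Inter>n. V n)"
  have N: "N \<in> sets M"
    unfolding N_def sets using V(1) by (auto intro!: sets.countable_INT)
  have le: "emeasure M N \<le> ennreal (1 / Suc n)" for n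
  proof -
    have "emeasure M N \<le> emeasure M (V n)"
      using V(1) sets by (intro emeasure_mono) (auto simp: N_def)
    then show ?thesis
      using V(3)[of n] by (simp add: order.trans less_imp_le)
  qed
  have "(\<lambda>n. ennreal (1 / Suc n)) \<longlonglongrightarrow> ennreal 0"
    using lim_1_over_n LIMSEQ_Suc by (intro tendsto_ennrealI) fastforce
  then have "emeasure M N \<le> ennreal 0"
    using le by (intro LIMSEQ_le_const) auto
  then show "\<exists>N\<in>null_sets M. A \<subseteq> N"
    using N V(2) by (intro bexI[of _ N]) (auto simp: null_sets_def N_def)
qed


section \<open>Continuous measure-preserving actions\<close>

definition continuous_action ::
    "('g::topological_group_add \<Rightarrow> 'x::topological_space \<Rightarrow> 'x) \<Rightarrow> bool" where
  "continuous_action act \<longleftrightarrow>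
     (\<forall>x. act 0 x = x) \<and> (\<forall>g h x. act (g + h) x = act g (act h x)) \<and>
     continuous_on UNIV (\<lambda>(g, x). act g x)"

definition preserves_measure :: "('g \<Rightarrow> 'x \<Rightarrow> 'x) \<Rightarrow> 'x measure \<Rightarrow> bool" where
  "preserves_measure act M \<longleftrightarrow>
     (\<forall>g. \<forall>A\<in>sets M. act g -` A \<inter> space M \<in> sets M \<and>
        emeasure M (act g -` A \<inter> space M) = emeasure M A)"

definition stabilizer :: "('g \<Rightarrow> 'x \<Rightarrow> 'x) \<Rightarrow> 'x \<Rightarrow> 'g set" where
  "stabilizer act x = {g. act g x = x}"


section \<open>Square-integrable functions and operators on them\<close>

text \<open>
  Vectors of the complex Hilbert spaces \<open>L\<^sup>2\<close> and \<open>L\<^sup>2\<^sub>0\<close> are represented by functions; two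
  functions represent the same vector if they agree almost everywhere.
\<close>

definition L2 :: "'a measure \<Rightarrow> ('a \<Rightarrow> complex) set" where
  "L2 M = {f \<in> borel_measurable M. integrable M (\<lambda>x. (cmod (f x))\<^sup>2)}"

definition L2_0 :: "'a measure \<Rightarrow> ('a \<Rightarrow> complex) set" where
  "L2_0 M = {f \<in> L2 M. (\<integral>x. f x \<partial>M) = 0}"

definition inner2 :: "'a measure \<Rightarrow> ('a \<Rightarrow> complex) \<Rightarrow> ('a \<Rightarrow> complex) \<Rightarrow> complex" where
  "inner2 M f h = (\<integral>x. f x * cnj (h x) \<partial>M)"

definition norm2 :: "'a measure \<Rightarrow> ('a \<Rightarrow> complex) \<Rightarrow> real" where
  "norm2 M f = sqrt (\<integral>x. (cmod (f x))\<^sup>2 \<partial>M)"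

text \<open>
  Below, \<open>H\<close> is one of the spaces \<open>L2 M\<close> and \<open>L2_0 M\<close>. A bounded operator respects equality almost
  everywhere by linearity and boundedness.
\<close>

definition bounded_operator ::
    "'a measure \<Rightarrow> ('a \<Rightarrow> complex) set \<Rightarrow> (('a \<Rightarrow> complex) \<Rightarrow> 'a \<Rightarrow> complex) \<Rightarrow> bool" where
  "bounded_operator M H T \<longleftrightarrow>
     (\<forall>\<xi>\<in>H. T \<xi> \<in> H) \<and>
     (\<forall>\<xi>\<in>H. \<forall>\<eta>\<in>H. AE x in M. T (\<lambda>y. \<xi> y + \<eta> y) x = T \<xi> x + T \<eta> x) \<and>
     (\<forall>c. \<forall>\<xi>\<in>H. AE x in M. T (\<lambda>y. c * \<xi> y) x = c * T \<xi> x) \<and>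
     (\<exists>C. \<forall>\<xi>\<in>H. norm2 M (T \<xi>) \<le> C * norm2 M \<xi>)"

definition operator_norm ::
    "'a measure \<Rightarrow> ('a \<Rightarrow> complex) set \<Rightarrow> (('a \<Rightarrow> complex) \<Rightarrow> 'a \<Rightarrow> complex) \<Rightarrow> real" where
  "operator_norm M H T = (SUP \<xi>\<in>{\<xi>\<in>H. norm2 M \<xi> \<le> 1}. norm2 M (T \<xi>))"

definition strongly_continuous ::
    "'a measure \<Rightarrow> ('a \<Rightarrow> complex) set \<Rightarrow>
     ('g::topological_space \<Rightarrow> ('a \<Rightarrow> complex) \<Rightarrow> 'a \<Rightarrow> complex) \<Rightarrow> bool" where
  "strongly_continuous M H \<pi> \<longleftrightarrow>
     (\<forall>\<xi>\<in>H. \<forall>g\<^sub>0. ((\<lambda>g. norm2 M (\<lambda>x. \<pi> g \<xi> x - \<pi> g\<^sub>0 \<xi> x)) \<longlongrightarrow> 0) (at g\<^sub>0))"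

text \<open>\<open>T\<close> is the operator \<open>\<pi>(\<mu>)\<close>, which is determined up to equality almost everywhere.\<close>

definition is_integrated_operator ::
    "'a measure \<Rightarrow> ('a \<Rightarrow> complex) set \<Rightarrow>
     ('g::topological_space \<Rightarrow> ('a \<Rightarrow> complex) \<Rightarrow> 'a \<Rightarrow> complex) \<Rightarrow> 'g measure \<Rightarrow>
     (('a \<Rightarrow> complex) \<Rightarrow> 'a \<Rightarrow> complex) \<Rightarrow> bool" where
  "is_integrated_operator M H \<pi> \<mu> T \<longleftrightarrow>
     bounded_operator M H T \<and>
     (\<forall>\<xi>\<in>H. \<forall>\<eta>\<in>H. integrable \<mu> (\<lambda>g. inner2 M (\<pi> g \<xi>) \<eta>) \<and>
        inner2 M (T \<xi>) \<eta> = (\<integral>g. inner2 M (\<pi> g \<xi>) \<eta> \<partial>\<mu>))"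


section \<open>The Koopman and the left regular representation\<close>

definition koopman ::
    "('g::group_add \<Rightarrow> 'x \<Rightarrow> 'x) \<Rightarrow> 'g \<Rightarrow> ('x \<Rightarrow> complex) \<Rightarrow> 'x \<Rightarrow> complex" where
  "koopman act g \<phi> = (\<lambda>x. \<phi> (act (- g) x))"

definition left_regular :: "'g::group_add \<Rightarrow> ('g \<Rightarrow> complex) \<Rightarrow> 'g \<Rightarrow> complex" where
  "left_regular g \<phi> = (\<lambda>h. \<phi> (- g + h))"

end

theory Submission
  imports Defs
begin

text \<open>
  The coefficients of the regular representation against non-negative functions \<open>f\<close> and \<open>h\<close> on
  \<open>G\<close> are dominated by coefficients of the Koopman representation. For a set \<open>U \<subseteq> X\<close> of positive
  measure, transplant \<open>f\<close> to the function \<open>F \<ge> 0\<close> on \<open>X\<close> with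
  \<open>F(x)\<^sup>2 = \<integral> f(g)\<^sup>2 1\<^bsub>gU\<^esub>(x) dg\<close>, and \<open>h\<close> to \<open>H\<close> likewise. Then \<open>\<parallel>F\<parallel>\<^sup>2 = \<nu>(U) \<parallel>f\<parallel>\<^sup>2\<close>, because
  \<open>\<nu>\<close> is invariant. Left invariance of the Haar measure shows that \<open>F(s\<^sup>-\<^sup>1x)\<^sup>2\<close> arises from the
  translate \<open>f(s\<^sup>-\<^sup>1g)\<close> in the same way, so that the Cauchy--Schwarz inequality in \<open>g\<close> gives
  \<open>F(s\<^sup>-\<^sup>1x) H(x) \<ge> \<integral> f(s\<^sup>-\<^sup>1g) h(g) 1\<^bsub>gU\<^esub>(x) dg\<close>. Integration over \<open>x\<close> yields
  \<open>\<nu>(U) \<langle>\<lambda>\<^sub>G(s)f, h\<rangle> \<le> \<langle>\<pi>(s)F, H\<rangle>\<close> for every \<open>s\<close>, where \<open>\<pi>\<close> is the Koopman representation on all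
  of \<open>L\<^sup>2\<close> (\<open>left_regular_le_koopman_transplant\<close>).

  It remains to pass to \<open>L\<^sup>2\<^sub>0\<close>, and here the point \<open>x\<^sub>0\<close> enters. Subtracting the means of \<open>F\<close> and \<open>H\<close>
  changes the coefficient by \<open>(\<integral>F)(\<integral>H)\<close>. If \<open>f\<close> and \<open>h\<close> are supported in a compact set \<open>K\<close>, choose
  an open \<open>V \<supseteq> K x\<^sub>0\<close> of measure less than \<open>\<epsilon>\<close> and, by compactness, an open neighbourhood \<open>U\<close> of
  \<open>x\<^sub>0\<close> with \<open>K U \<subseteq> V\<close>; it has positive measure since \<open>x\<^sub>0\<close> lies in the support. Now \<open>F\<close> and \<open>H\<close> vanish
  outside \<open>V\<close>, and therefore \<open>(\<integral>F)(\<integral>H) \<le> \<epsilon> \<parallel>F\<parallel> \<parallel>H\<parallel> = \<epsilon> \<nu>(U) \<parallel>f\<parallel> \<parallel>h\<parallel>\<close>. Integrating over \<open>\<mu>\<close>, dividing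
  by \<open>\<nu>(U)\<close> and letting \<open>\<epsilon>\<close> tend to \<open>0\<close> bounds \<open>|\<langle>\<lambda>\<^sub>G(\<mu>)f, h\<rangle>|\<close> by \<open>\<parallel>\<pi>\<^sub>0(\<mu>)\<parallel> \<parallel>f\<parallel> \<parallel>h\<parallel>\<close>
  (\<open>cmod_inner2_integrated_le_of_compact_support\<close>), and compactly supported functions are dense.

  The topologies need not have countable bases, so that \<open>(g, x) \<mapsto> 1\<^bsub>gU\<^esub>(x)\<close> may fail to be measurable
  for the product \<open>\<sigma>\<close>-algebra and Fubini's theorem is not at hand. Strong continuity of the Koopman
  representation makes \<open>g \<mapsto> \<nu>(gU \<inter> A)\<close> continuous for every measurable \<open>A\<close>; hence
  \<open>A \<mapsto> \<integral> w(g) \<nu>(gU \<inter> A) dg\<close> is a measure, absolutely continuous with respect to \<open>\<nu>\<close>, and its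
  Radon--Nikodym density \<open>spread U w\<close> stands in for the integral \<open>\<integral> w(g) 1\<^bsub>gU\<^esub>(x) dg\<close>.
\<close>


section \<open>The inner product and the norm of square-integrable functions\<close>

lemma L2_integrable_cmod_mult:
  assumes "f \<in> L2 M" "h \<in> L2 M"
  shows "integrable M (\<lambda>x. cmod (f x) * cmod (h x))"
proof (rule Bochner_Integration.integrable_bound)
  show "integrable M (\<lambda>x. (cmod (f x))\<^sup>2 + (cmod (h x))\<^sup>2)"
    using assms by (auto simp: L2_def)
  show "(\<lambda>x. cmod (f x) * cmod (h x)) \<in> borel_measurable M"
    using assms by (auto simp: L2_def)
  have "a * b \<le> a\<^sup>2 + b\<^sup>2" if "a \<ge> 0" "b \<ge> 0" for a b :: real
    using sum_squares_bound[of a b] mult_nonneg_nonneg[OF that] by linarith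
  then show "AE x in M. norm (cmod (f x) * cmod (h x)) \<le> norm ((cmod (f x))\<^sup>2 + (cmod (h x))\<^sup>2)"
    by auto
qed

lemma borel_measurable_cnj [measurable]:
  assumes [measurable]: "f \<in> borel_measurable M"
  shows "(\<lambda>x. cnj (f x)) \<in> borel_measurable M"
proof -
  have [measurable]: "cnj \<in> borel_measurable borel"
    by (intro borel_measurable_continuous_onI continuous_intros)
  show ?thesis
    by measurable
qed

lemma L2_integrable_mult_cnj:
  assumes "f \<in> L2 M" "h \<in> L2 M"
  shows "integrable M (\<lambda>x. f x * cnj (h x))"
  by (rule Bochner_Integration.integrable_bound[OF L2_integrable_cmod_mult[OF assms]])
    (use assms in \<open>auto simp: L2_def norm_mult\<close>)

lemma norm2_nonneg [simp]: "norm2 M f \<ge> 0"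
  by (simp add: norm2_def)

lemma norm2_power2: "(norm2 M f)\<^sup>2 = (\<integral>x. (cmod (f x))\<^sup>2 \<partial>M)"
  by (simp add: norm2_def)

lemma nn_integral_cmod_power2:
  assumes "f \<in> L2 M"
  shows "(\<integral>\<^sup>+x. ennreal ((cmod (f x))\<^sup>2) \<partial>M) = ennreal ((norm2 M f)\<^sup>2)"
  unfolding norm2_power2 using assms by (intro nn_integral_eq_integral) (auto simp: L2_def)

lemma integral_cmod_mult_le:
  assumes "f \<in> L2 M" "h \<in> L2 M"
  shows "(\<integral>x. cmod (f x) * cmod (h x) \<partial>M) \<le> norm2 M f * norm2 M h"
proof -
  have meas: "f \<in> borel_measurable M" "h \<in> borel_measurable M"
    using assms by (auto simp: L2_def)
  let ?I = "\<integral>x. cmod (f x) * cmod (h x) \<partial>M"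
  have I: "ennreal ?I = (\<integral>\<^sup>+x. ennreal (cmod (f x)) * ennreal (cmod (h x)) \<partial>M)"
    using nn_integral_eq_integral[OF L2_integrable_cmod_mult[OF assms]] by (simp add: ennreal_mult)
  have "ennreal (?I\<^sup>2) = (\<integral>\<^sup>+x. ennreal (cmod (f x)) * ennreal (cmod (h x)) \<partial>M)\<^sup>2"
    unfolding I[symmetric] by (intro ennreal_power[symmetric]) (auto intro!: integral_nonneg)
  also have "\<dots> \<le> (\<integral>\<^sup>+x. (ennreal (cmod (f x)))\<^sup>2 \<partial>M) * (\<integral>\<^sup>+x. (ennreal (cmod (h x)))\<^sup>2 \<partial>M)"
    using meas by (intro Cauchy_Schwarz_nn_integral) auto
  also have "\<dots> = ennreal ((norm2 M f * norm2 M h)\<^sup>2)"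
    using assms by (simp add: ennreal_power nn_integral_cmod_power2 ennreal_mult power_mult_distrib)
  finally have "?I\<^sup>2 \<le> (norm2 M f * norm2 M h)\<^sup>2"
    by (subst (asm) ennreal_le_iff) auto
  then show ?thesis
    by (rule power2_le_imp_le) simp
qed

lemma cmod_inner2_le_integral:
  assumes "f \<in> L2 M" "h \<in> L2 M"
  shows "cmod (inner2 M f h) \<le> (\<integral>x. cmod (f x) * cmod (h x) \<partial>M)"
proof -
  have "cmod (inner2 M f h) \<le> (\<integral>x. cmod (f x * cnj (h x)) \<partial>M)"
    unfolding inner2_def by (rule integral_norm_bound)
  then show ?thesis
    by (simp only: norm_mult complex_mod_cnj)
qed

lemma cmod_inner2_le:
  assumes "f \<in> L2 M" "h \<in> L2 M"
  shows "cmod (inner2 M f h) \<le> norm2 M f * norm2 M h"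
  using cmod_inner2_le_integral[OF assms] integral_cmod_mult_le[OF assms] by (rule order.trans)

lemma inner2_self: "inner2 M f f = complex_of_real ((norm2 M f)\<^sup>2)"
  by (simp only: inner2_def norm2_power2 complex_norm_square[symmetric] integral_complex_of_real)

lemma L2_add:
  assumes "f \<in> L2 M" "h \<in> L2 M"
  shows "(\<lambda>x. f x + h x) \<in> L2 M"
proof -
  have [measurable]: "f \<in> borel_measurable M" "h \<in> borel_measurable M"
    using assms by (auto simp: L2_def)
  have "integrable M (\<lambda>x. (cmod (f x + h x))\<^sup>2)"
  proof (rule Bochner_Integration.integrable_bound)
    show "integrable M (\<lambda>x. 2 * (cmod (f x))\<^sup>2 + 2 * (cmod (h x))\<^sup>2)"
      using assms by (auto simp: L2_def)
    have "(cmod (a + b))\<^sup>2 \<le> 2 * (cmod a)\<^sup>2 + 2 * (cmod b)\<^sup>2" for a b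
    proof -
      have "(cmod (a + b))\<^sup>2 \<le> (cmod a + cmod b)\<^sup>2"
        by (intro power_mono norm_triangle_ineq) auto
      also have "\<dots> \<le> 2 * (cmod a)\<^sup>2 + 2 * (cmod b)\<^sup>2"
        using sum_squares_bound[of "cmod a" "cmod b"] by (simp add: power2_sum)
      finally show ?thesis .
    qed
    then show "AE x in M. norm ((cmod (f x + h x))\<^sup>2) \<le> norm (2 * (cmod (f x))\<^sup>2 + 2 * (cmod (h x))\<^sup>2)"
      by auto
  qed measurable
  then show ?thesis
    by (auto simp: L2_def)
qed

lemma L2_scale: "f \<in> L2 M \<Longrightarrow> (\<lambda>x. c * f x) \<in> L2 M"
  by (auto simp: L2_def norm_mult power_mult_distrib)

lemma norm2_scale: "norm2 M (\<lambda>x. c * f x) = cmod c * norm2 M f"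
  by (simp add: norm2_def norm_mult power_mult_distrib real_sqrt_mult)

lemma L2_diff: "f \<in> L2 M \<Longrightarrow> h \<in> L2 M \<Longrightarrow> (\<lambda>x. f x - h x) \<in> L2 M"
  using L2_add[of f M "\<lambda>x. -1 * h x"] L2_scale[of h M "-1"] by simp

lemma L2_restrict:
  assumes "f \<in> L2 M" "A \<in> sets M"
  shows "(\<lambda>x. indicator A x * f x) \<in> L2 M" "norm2 M (\<lambda>x. indicator A x * f x) \<le> norm2 M f"
proof -
  have [measurable]: "f \<in> borel_measurable M" "A \<in> sets M"
    using assms by (auto simp: L2_def)
  have f: "integrable M (\<lambda>x. (cmod (f x))\<^sup>2)"
    using assms by (auto simp: L2_def)
  have I: "integrable M (\<lambda>x. (cmod (indicator A x * f x))\<^sup>2)"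
    by (rule Bochner_Integration.integrable_bound[OF f]) (auto split: split_indicator)
  then show "(\<lambda>x. indicator A x * f x) \<in> L2 M"
    by (auto simp: L2_def)
  show "norm2 M (\<lambda>x. indicator A x * f x) \<le> norm2 M f"
    unfolding norm2_def by (intro real_sqrt_le_mono integral_mono I f) (auto split: split_indicator)
qed

lemma norm2_AE_cong:
  assumes "AE x in M. f x = h x" "f \<in> borel_measurable M" "h \<in> borel_measurable M"
  shows "norm2 M f = norm2 M h"
  unfolding norm2_def using assms by (intro arg_cong[of _ _ sqrt] integral_cong_AE) auto

lemma inner2_AE_cong:
  assumes "AE x in M. f x = f' x" "f \<in> borel_measurable M" "f' \<in> borel_measurable M"
    "h \<in> borel_measurable M"
  shows "inner2 M f h = inner2 M f' h"
  unfolding inner2_def using assms by (intro integral_cong_AE) auto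

lemma inner2_add_left:
  assumes "f \<in> L2 M" "f' \<in> L2 M" "h \<in> L2 M"
  shows "inner2 M (\<lambda>x. f x + f' x) h = inner2 M f h + inner2 M f' h"
  using assms by (simp add: inner2_def distrib_right L2_integrable_mult_cnj)

lemma inner2_add_right:
  assumes "f \<in> L2 M" "h \<in> L2 M" "h' \<in> L2 M"
  shows "inner2 M f (\<lambda>x. h x + h' x) = inner2 M f h + inner2 M f h'"
  using assms by (simp add: inner2_def distrib_left L2_integrable_mult_cnj)


section \<open>The norm of a bounded operator\<close>

lemma bdd_above_operator_norm:
  assumes "bounded_operator M H T"
  shows "bdd_above ((\<lambda>\<xi>. norm2 M (T \<xi>)) ` {\<xi>\<in>H. norm2 M \<xi> \<le> 1})"
proof -
  obtain C where C: "\<And>\<xi>. \<xi> \<in> H \<Longrightarrow> norm2 M (T \<xi>) \<le> C * norm2 M \<xi>"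
    using assms unfolding bounded_operator_def by blast
  have "norm2 M (T \<xi>) \<le> \<bar>C\<bar>" if "\<xi> \<in> H" "norm2 M \<xi> \<le> 1" for \<xi>
  proof -
    have "norm2 M (T \<xi>) \<le> \<bar>C\<bar> * norm2 M \<xi>"
      using C[OF that(1)] mult_right_mono[OF abs_ge_self norm2_nonneg] by (rule order.trans)
    also have "\<dots> \<le> \<bar>C\<bar>"
      using that(2) by (simp add: mult_left_le)
    finally show ?thesis .
  qed
  then show ?thesis
    by (intro bdd_aboveI2[of _ _ "\<bar>C\<bar>"]) auto
qed

text \<open>
  Vectors of norm \<open>0\<close> need not be zero functions, so that they cannot be normalized; for them the
  inequality follows from boundedness.
\<close>
lemma norm2_le_operator_norm:
  assumes T: "bounded_operator M H T" and "H \<subseteq> L2 M"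
    and scale: "\<And>c f. f \<in> H \<Longrightarrow> (\<lambda>x. c * f x) \<in> H" and \<xi>: "\<xi> \<in> H"
  shows "norm2 M (T \<xi>) \<le> operator_norm M H T * norm2 M \<xi>"
proof (cases "norm2 M \<xi> = 0")
  case True
  then have "norm2 M (T \<xi>) \<le> 0"
    using T \<xi> by (auto simp: bounded_operator_def)
  then show ?thesis
    using True by simp
next
  case False
  then have pos: "norm2 M \<xi> > 0"
    using norm2_nonneg[of M \<xi>] by linarith
  define c where "c = complex_of_real (1 / norm2 M \<xi>)"
  have c: "cmod c = 1 / norm2 M \<xi>"
    using pos by (simp add: c_def norm_divide)
  have "norm2 M (T (\<lambda>x. c * \<xi> x)) \<le> operator_norm M H T"
    unfolding operator_norm_def
  proof (rule cSUP_upper)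
    show "(\<lambda>x. c * \<xi> x) \<in> {\<xi> \<in> H. norm2 M \<xi> \<le> 1}"
      using scale[OF \<xi>] pos by (simp add: norm2_scale c)
  qed (rule bdd_above_operator_norm[OF T])
  moreover have "norm2 M (T (\<lambda>x. c * \<xi> x)) = norm2 M (\<lambda>x. c * T \<xi> x)"
  proof (rule norm2_AE_cong)
    have "T \<xi> \<in> H" "T (\<lambda>x. c * \<xi> x) \<in> H"
      using T \<xi> scale[OF \<xi>] by (auto simp: bounded_operator_def)
    then show "(T (\<lambda>x. c * \<xi> x)) \<in> borel_measurable M" "(\<lambda>x. c * T \<xi> x) \<in> borel_measurable M"
      using assms(2) by (auto simp: L2_def)
  qed (use T \<xi> in \<open>auto simp: bounded_operator_def\<close>)
  ultimately show ?thesis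
    using pos by (simp add: norm2_scale c field_simps)
qed

lemma operator_norm_nonneg:
  assumes "bounded_operator M H T" "(\<lambda>x. 0) \<in> H"
  shows "operator_norm M H T \<ge> 0"
proof -
  have "norm2 M (T (\<lambda>x. 0)) \<le> operator_norm M H T"
    unfolding operator_norm_def using assms
    by (intro cSUP_upper bdd_above_operator_norm) (auto simp: norm2_def)
  then show ?thesis
    using norm2_nonneg by (rule order.trans[rotated])
qed

lemma zero_L2_0: "(\<lambda>x. 0) \<in> L2_0 M"
  by (simp add: L2_0_def L2_def)

lemma L2_0_subset_L2: "L2_0 M \<subseteq> L2 M"
  by (auto simp: L2_0_def)

lemma L2_0_scale:
  assumes "f \<in> L2_0 M"
  shows "(\<lambda>x. c * f x) \<in> L2_0 M"
  using assms L2_scale[of f M c] by (simp add: L2_0_def)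


section \<open>Approximation by compactly supported functions\<close>

text \<open>
  Inner regularity is assumed for open sets, while the set to be exhausted, on which \<open>|f|\<^sup>2\<close> is
  bounded both from above and away from \<open>0\<close>, is merely a Borel set of finite measure. The compact
  set need not lie inside it, however: it is enough to enclose it in an open set \<open>V\<close> of finite
  measure and to exhaust \<open>V\<close>.
\<close>
lemma L2_compact_approx:
  fixes M :: "'a::t2_space measure"
  assumes sets_M: "sets M = sets borel"
    and outer: "outer_regular_on (sets borel) M" and inner: "inner_regular_on {U. open U} M"
    and f: "f \<in> L2 M" and \<delta>: "\<delta> > 0"
  shows "\<exists>K. compact K \<and> norm2 M (\<lambda>x. indicator (- K) x * f x) \<le> \<delta>"
proof -
  have space_M [simp]: "space M = UNIV"
    using sets_eq_imp_space_eq[OF sets_M] by simp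
  define u where "u = (\<lambda>x. (cmod (f x))\<^sup>2)"
  have [measurable]: "f \<in> borel_measurable M"
    using f by (simp add: L2_def)
  have [measurable]: "u \<in> borel_measurable M"
    unfolding u_def by measurable
  have u: "integrable M u" and u_nonneg: "\<And>x. u x \<ge> 0"
    using f by (auto simp: L2_def u_def)
  \<comment> \<open>The lower cutoff makes the complement of \<open>D n\<close> a set of finite measure; the upper one turns
    smallness in measure into smallness of the integral of \<open>u\<close>.\<close>
  define D where "D = (\<lambda>n::nat. {x. u x \<le> 1 / Suc n \<or> u x > n})"
  have D [measurable]: "D n \<in> sets M" for n
  proof -
    have "{x \<in> space M. u x \<le> 1 / Suc n \<or> u x > n} \<in> sets M"
      by measurable
    then show ?thesis
      by (simp add: D_def)
  qed
  have "(\<lambda>n. \<integral>x. indicator (D n) x * u x \<partial>M) \<longlonglongrightarrow> (\<integral>x. 0 \<partial>M)"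
  proof (rule integral_dominated_convergence)
    show "AE x in M. (\<lambda>n. indicator (D n) x * u x) \<longlonglongrightarrow> 0"
    proof (rule AE_I2)
      fix x
      show "(\<lambda>n. indicator (D n) x * u x) \<longlonglongrightarrow> 0"
      proof (cases "u x = 0")
        case False
        then have pos: "u x > 0"
          using u_nonneg[of x] by linarith
        have "\<forall>\<^sub>F n in sequentially. 1 / real (Suc n) < u x"
          using order_tendstoD(2)[OF LIMSEQ_Suc[OF lim_1_over_n] pos] by simp
        moreover have "\<forall>\<^sub>F n in sequentially. u x \<le> real n"
          using eventually_ge_at_top[of "nat \<lceil>u x\<rceil>"] by eventually_elim linarith
        ultimately have "\<forall>\<^sub>F n in sequentially. indicator (D n) x * u x = 0"
          by eventually_elim (auto simp: D_def)
        then show ?thesis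
          by (rule tendsto_eventually)
      qed auto
    qed
    show "AE x in M. norm (indicator (D n) x * u x) \<le> u x" for n
      using u_nonneg by (auto split: split_indicator)
  qed (use u in auto)
  then have "\<forall>\<^sub>F n in sequentially. (\<integral>x. indicator (D n) x * u x \<partial>M) < \<delta>\<^sup>2 / 2"
    using \<delta> by (intro order_tendstoD(2)) auto
  then obtain n where n: "(\<integral>x. indicator (D n) x * u x \<partial>M) < \<delta>\<^sup>2 / 2"
    by (auto simp: eventually_sequentially)
  have A: "- D n \<in> sets M"
    using D[of n] by (metis Compl_eq_Diff_UNIV sets.compl_sets space_M)
  have "emeasure M (- D n) = (\<integral>\<^sup>+x. indicator (- D n) x \<partial>M)"
    using A by simp
  also have "\<dots> \<le> (\<integral>\<^sup>+x. ennreal (Suc n * u x) \<partial>M)"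
  proof (rule nn_integral_mono)
    fix x
    have "1 \<le> Suc n * u x" if "x \<notin> D n"
      using that by (auto simp: D_def field_simps)
    then show "indicator (- D n) x \<le> ennreal (Suc n * u x)"
      by (auto split: split_indicator)
  qed
  also have "\<dots> = ennreal (\<integral>x. Suc n * u x \<partial>M)"
    using u u_nonneg by (intro nn_integral_eq_integral) auto
  also have "\<dots> < \<infinity>"
    by simp
  finally have "(INF V\<in>{V. open V \<and> - D n \<subseteq> V}. emeasure M V) < \<infinity>"
    using outer A sets_M by (simp add: outer_regular_on_def)
  then obtain V where V: "open V" "- D n \<subseteq> V" "emeasure M V < \<infinity>"
    unfolding INF_less_iff by blast
  define \<eta> where "\<eta> = \<delta>\<^sup>2 / (2 * Suc n)"
  have \<eta>: "\<eta> > 0" "real n * \<eta> \<le> \<delta>\<^sup>2 / 2"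
    using \<delta> by (auto simp: \<eta>_def field_simps)
  have "\<exists>K\<in>{K. compact K \<and> K \<subseteq> V}. emeasure M V < emeasure M K + ennreal \<eta>"
  proof (rule SUP_approx_ennreal)
    show "emeasure M V = (SUP K\<in>{K. compact K \<and> K \<subseteq> V}. emeasure M K)"
      using inner V(1) by (simp add: inner_regular_on_def)
  qed (use V \<eta> in auto)
  then obtain K where K: "compact K" "K \<subseteq> V" "emeasure M V < emeasure M K + ennreal \<eta>"
    by blast
  have VK [measurable]: "V \<in> sets M" "K \<in> sets M"
    using V(1) compact_imp_closed[OF K(1)] by (auto simp: sets_M)
  have "emeasure M V = emeasure M K + emeasure M (V - K)"
    using plus_emeasure[of K M "V - K"] VK K(2) by (simp add: Un_absorb1)
  then have "emeasure M (V - K) \<le> ennreal \<eta>"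
    using K(3) V(3) by (metis ennreal_add_left_cancel_less less_imp_le)
  then have VK_measure: "measure M (V - K) \<le> \<eta>" "emeasure M (V - K) < \<infinity>"
    using \<eta>(1) by (auto simp: measure_def enn2real_leI intro: le_less_trans)
  have "(norm2 M (\<lambda>x. indicator (- K) x * f x))\<^sup>2 = (\<integral>x. indicator (- K) x * u x \<partial>M)"
    unfolding norm2_power2 u_def by (intro Bochner_Integration.integral_cong) (auto split: split_indicator)
  also have "\<dots> \<le> (\<integral>x. indicator (D n) x * u x + real n * indicator (V - K) x \<partial>M)"
  proof (rule integral_mono)
    show "integrable M (\<lambda>x. indicator (- K) x * u x)"
      by (rule Bochner_Integration.integrable_bound[OF u]) (auto split: split_indicator)
    show "integrable M (\<lambda>x. indicator (D n) x * u x + real n * indicator (V - K) x)"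
    proof (intro Bochner_Integration.integrable_add integrable_mult_right)
      show "integrable M (\<lambda>x. indicator (D n) x * u x)"
        by (rule Bochner_Integration.integrable_bound[OF u]) (auto split: split_indicator)
      show "integrable M (indicator (V - K) :: 'a \<Rightarrow> real)"
        using VK_measure(2) by (intro integrable_real_indicator) auto
    qed
    show "indicator (- K) x * u x \<le> indicator (D n) x * u x + real n * indicator (V - K) x" for x
      using V(2) u_nonneg[of x] by (cases "x \<in> D n") (auto simp: D_def split: split_indicator)
  qed
  also have "\<dots> = (\<integral>x. indicator (D n) x * u x \<partial>M) + real n * measure M (V - K)"
  proof (subst Bochner_Integration.integral_add)
    show "integrable M (\<lambda>x. indicator (D n) x * u x)"
      by (rule Bochner_Integration.integrable_bound[OF u]) (auto split: split_indicator)
    show "integrable M (\<lambda>x. real n * indicator (V - K) x :: real)"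
      using VK_measure(2) by (intro integrable_mult_right integrable_real_indicator) auto
  qed auto
  also have "\<dots> \<le> \<delta>\<^sup>2"
    using n mult_left_mono[OF VK_measure(1), of "real n"] \<eta>(2) by simp
  finally have "norm2 M (\<lambda>x. indicator (- K) x * f x) \<le> \<delta>"
    by (rule power2_le_imp_le) (use \<delta> in simp)
  then show ?thesis
    using K(1) by blast
qed

lemma norm_triangle3:
  "norm (a + b + c) \<le> norm a + norm b + norm c" for a b c :: "'a::real_normed_vector"
  using norm_triangle_ineq[of "a + b" c] norm_triangle_ineq[of a b] by linarith

text \<open>
  Passing to restrictions of both functions in a matrix coefficient costs little if the parts cut
  off have small norm.
\<close>
lemma inner2_operator_restrict_approx:
  assumes S: "bounded_operator M (L2 M) S" and C: "\<And>\<xi>. \<xi> \<in> L2 M \<Longrightarrow> norm2 M (S \<xi>) \<le> C * norm2 M \<xi>"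
    and f: "f \<in> L2 M" and h: "h \<in> L2 M" and A: "A \<in> sets M"
    and small: "norm2 M (\<lambda>x. indicator (- A) x * f x) \<le> \<delta>" "norm2 M (\<lambda>x. indicator (- A) x * h x) \<le> \<delta>"
    and "space M = UNIV"
  shows "cmod (inner2 M (S f) h) \<le>
    cmod (inner2 M (S (\<lambda>x. indicator A x * f x)) (\<lambda>x. indicator A x * h x)) +
      \<bar>C\<bar> * \<delta> * (norm2 M f + norm2 M h)"
proof -
  let ?f = "\<lambda>x. indicator A x * f x" and ?h = "\<lambda>x. indicator A x * h x"
  let ?f' = "\<lambda>x. indicator (- A) x * f x" and ?h' = "\<lambda>x. indicator (- A) x * h x"
  have A': "- A \<in> sets M"
    using A assms(8) by (metis Compl_eq_Diff_UNIV sets.compl_sets)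
  note L = L2_restrict[OF f A] L2_restrict[OF f A'] L2_restrict[OF h A] L2_restrict[OF h A']
  have SL: "S \<xi> \<in> L2 M" if "\<xi> \<in> L2 M" for \<xi>
    using S that by (auto simp: bounded_operator_def)
  have C': "norm2 M (S \<xi>) \<le> \<bar>C\<bar> * norm2 M \<xi>" if "\<xi> \<in> L2 M" for \<xi>
    using C[OF that] mult_right_mono[OF abs_ge_self norm2_nonneg] by (rule order.trans)
  have feq: "f = (\<lambda>x. ?f x + ?f' x)" and heq: "h = (\<lambda>x. ?h x + ?h' x)"
    by (auto split: split_indicator)
  have "AE x in M. S (\<lambda>x. ?f x + ?f' x) x = S ?f x + S ?f' x"
    using S L by (auto simp: bounded_operator_def)
  then have AE: "AE x in M. S f x = S ?f x + S ?f' x"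
    using feq by simp
  have "inner2 M (S f) h = inner2 M (\<lambda>x. S ?f x + S ?f' x) h"
    using AE SL[OF f] L2_add[OF SL[OF L(1)] SL[OF L(3)]] h
    by (intro inner2_AE_cong) (auto simp: L2_def)
  also have "\<dots> = inner2 M (S ?f) h + inner2 M (S ?f') h"
    using L SL h by (intro inner2_add_left) auto
  also have "inner2 M (S ?f) h = inner2 M (S ?f) ?h + inner2 M (S ?f) ?h'"
    by (subst heq, rule inner2_add_right) (use L SL in auto)
  finally have "cmod (inner2 M (S f) h) \<le>
      cmod (inner2 M (S ?f) ?h) + cmod (inner2 M (S ?f) ?h') + cmod (inner2 M (S ?f') h)"
    by (simp only: norm_triangle3)
  moreover have "cmod (inner2 M (S ?f) ?h') \<le> \<bar>C\<bar> * norm2 M f * \<delta>"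
  proof -
    have "cmod (inner2 M (S ?f) ?h') \<le> norm2 M (S ?f) * norm2 M ?h'"
      using L SL by (intro cmod_inner2_le) auto
    also have "\<dots> \<le> (\<bar>C\<bar> * norm2 M f) * \<delta>"
    proof (intro mult_mono small)
      show "norm2 M (S ?f) \<le> \<bar>C\<bar> * norm2 M f"
        using C'[OF L(1)] mult_left_mono[OF L(2) abs_ge_zero] by (rule order.trans)
    qed auto
    finally show ?thesis .
  qed
  moreover have "cmod (inner2 M (S ?f') h) \<le> \<bar>C\<bar> * \<delta> * norm2 M h"
  proof -
    have "cmod (inner2 M (S ?f') h) \<le> norm2 M (S ?f') * norm2 M h"
      using L SL h by (intro cmod_inner2_le) auto
    also have "\<dots> \<le> (\<bar>C\<bar> * \<delta>) * norm2 M h"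
    proof (intro mult_right_mono)
      show "norm2 M (S ?f') \<le> \<bar>C\<bar> * \<delta>"
        using C'[OF L(3)] mult_left_mono[OF small(1) abs_ge_zero] by (rule order.trans)
    qed auto
    finally show ?thesis .
  qed
  ultimately show ?thesis
    by (simp add: algebra_simps)
qed


section \<open>Measure-preserving actions with continuous Koopman representation\<close>

locale koopman_action = prob_space \<nu>
  for \<nu> :: "'x::topological_space measure" +
  fixes act :: "'g::{topological_group_add,t2_space} \<Rightarrow> 'x \<Rightarrow> 'x"
    and haar :: "'g measure"
  assumes sets_\<nu>: "sets \<nu> = sets borel"
    and continuous_action: "continuous_action act"
    and preserves_measure: "preserves_measure act \<nu>"
    and koopman_continuous: "strongly_continuous \<nu> (L2_0 \<nu>) (koopman act)"
    and haar: "left_haar_measure haar"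
begin

lemma space_\<nu> [simp]: "space \<nu> = UNIV"
  using sets_eq_imp_space_eq[OF sets_\<nu>] by simp

lemma prob_UNIV [simp]: "prob UNIV = 1"
  using prob_space by simp

lemma integrable_indicator: "A \<in> sets \<nu> \<Longrightarrow> integrable \<nu> (indicator A :: 'x \<Rightarrow> real)"
  by (intro integrable_real_indicator) (auto simp: emeasure_eq_measure)

lemma UNIV_sets_\<nu> [simp]: "UNIV \<in> sets \<nu>"
  using sets.top[of \<nu>] by simp

lemma sets_haar: "sets haar = sets borel"
  using haar by (simp add: left_haar_measure_def)

lemma space_haar [simp]: "space haar = UNIV"
  using sets_eq_imp_space_eq[OF sets_haar] by simp

lemma act_zero [simp]: "act 0 x = x"
  using continuous_action by (simp add: continuous_action_def)

lemma act_act: "act g (act h x) = act (g + h) x"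
  using continuous_action by (simp add: continuous_action_def)

lemma act_inverse [simp]: "act (- g) (act g x) = x" "act g (act (- g) x) = x"
  by (simp_all add: act_act)

lemma continuous_on_act: "continuous_on UNIV (act g)"
proof -
  have cont: "continuous_on UNIV (\<lambda>(g, x). act g x)"
    using continuous_action by (simp add: continuous_action_def)
  have pair: "continuous_on UNIV (\<lambda>x :: 'x. (g, x))"
    by (intro continuous_on_Pair continuous_on_const continuous_on_id)
  show ?thesis
    using continuous_on_compose[OF pair continuous_on_subset[OF cont subset_UNIV]]
    by (simp add: o_def)
qed

lemma measurable_act [measurable]: "act g \<in> measurable \<nu> \<nu>"
  using borel_measurable_continuous_onI[OF continuous_on_act] sets_\<nu>
  by (simp cong: measurable_cong_sets)

lemma distr_act: "distr \<nu> \<nu> (act g) = \<nu>"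
  using preserves_measure
  by (intro measure_eqI) (auto simp: emeasure_distr preserves_measure_def)

lemma emeasure_vimage_act: "A \<in> sets \<nu> \<Longrightarrow> emeasure \<nu> (act g -` A) = emeasure \<nu> A"
  using preserves_measure by (auto simp: preserves_measure_def)

lemma vimage_act_sets [measurable]: "A \<in> sets \<nu> \<Longrightarrow> act g -` A \<in> sets \<nu>"
  using measurable_sets[OF measurable_act, of A g] by simp

lemma nn_integral_act:
  assumes "f \<in> borel_measurable \<nu>"
  shows "(\<integral>\<^sup>+x. f (act g x) \<partial>\<nu>) = (\<integral>\<^sup>+x. f x \<partial>\<nu>)"
  using nn_integral_distr[OF measurable_act[of g], of f] assms by (simp add: distr_act)

lemma integral_act:
  fixes f :: "'x \<Rightarrow> 'b::{banach, second_countable_topology}"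
  assumes "f \<in> borel_measurable \<nu>"
  shows "(\<integral>x. f (act g x) \<partial>\<nu>) = (\<integral>x. f x \<partial>\<nu>)"
  using integral_distr[OF measurable_act[of g], of f] assms by (simp add: distr_act)

lemma integrable_act:
  fixes f :: "'x \<Rightarrow> 'b::{banach, second_countable_topology}"
  assumes "integrable \<nu> f"
  shows "integrable \<nu> (\<lambda>x. f (act g x))"
  using integrable_distr[OF measurable_act[of g], of f] assms by (simp add: distr_act)

lemma measurable_translate [measurable]: "(\<lambda>h. g + h) \<in> measurable haar haar"
proof -
  have "(\<lambda>h. g + h) \<in> borel_measurable (borel :: 'g measure)"
    by (intro borel_measurable_continuous_onI continuous_intros)
  then show ?thesis
    by (simp add: sets_haar cong: measurable_cong_sets)
qed

lemma distr_translate: "distr haar haar (\<lambda>h. g + h) = haar"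
proof (rule measure_eqI)
  fix A assume "A \<in> sets (distr haar haar (\<lambda>h. g + h))"
  then have A: "A \<in> sets haar"
    by simp
  have eq: "(\<lambda>h. g + h) -` A = (\<lambda>h. - g + h) ` A"
  proof safe
    fix x assume "g + x \<in> A"
    then show "x \<in> (\<lambda>h. - g + h) ` A"
      by (intro image_eqI[of _ _ "g + x"]) (simp_all add: add.assoc[symmetric])
  qed (simp add: add.assoc[symmetric])
  have "emeasure (distr haar haar (\<lambda>h. g + h)) A = emeasure haar ((\<lambda>h. - g + h) ` A)"
    using A by (simp add: emeasure_distr eq)
  also have "\<dots> = emeasure haar A"
    using haar A sets_haar unfolding left_haar_measure_def by blast
  finally show "emeasure (distr haar haar (\<lambda>h. g + h)) A = emeasure haar A" .
qed simp

lemma nn_integral_translate: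
  assumes "f \<in> borel_measurable haar"
  shows "(\<integral>\<^sup>+h. f (g + h) \<partial>haar) = (\<integral>\<^sup>+h. f h \<partial>haar)"
  using nn_integral_distr[OF measurable_translate[of g], of f] assms by (simp add: distr_translate)

lemma left_regular_L2:
  assumes "f \<in> L2 haar"
  shows "left_regular g f \<in> L2 haar"
proof -
  have "(\<lambda>h. f (- g + h)) \<in> borel_measurable haar"
    using assms by (intro measurable_compose[OF measurable_translate]) (auto simp: L2_def)
  moreover have "integrable haar (\<lambda>h. (cmod (f (- g + h)))\<^sup>2)"
    using integrable_distr[OF measurable_translate[of "- g"], of "\<lambda>h. (cmod (f h))\<^sup>2"] assms
    by (simp add: distr_translate L2_def)
  ultimately show ?thesis
    by (simp add: L2_def left_regular_def)
qed

lemma koopman_L2: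
  assumes "f \<in> L2 \<nu>"
  shows "koopman act g f \<in> L2 \<nu>"
proof -
  have "(\<lambda>x. f (act (- g) x)) \<in> borel_measurable \<nu>"
    using assms by (intro measurable_compose[OF measurable_act]) (auto simp: L2_def)
  moreover have "integrable \<nu> (\<lambda>x. (cmod (f (act (- g) x)))\<^sup>2)"
    using assms by (intro integrable_act[of "\<lambda>x. (cmod (f x))\<^sup>2"]) (auto simp: L2_def)
  ultimately show ?thesis
    by (simp add: L2_def koopman_def)
qed

lemma bounded_L2:
  assumes [measurable]: "f \<in> borel_measurable \<nu>" and "\<And>x. cmod (f x) \<le> B"
  shows "f \<in> L2 \<nu>"
proof -
  have "integrable \<nu> (\<lambda>x. (cmod (f x))\<^sup>2)"
    using assms(2) by (intro integrable_const_bound[of _ "B\<^sup>2"]) (auto intro!: power_mono)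
  then show ?thesis
    by (simp add: L2_def)
qed

lemma one_L2: "(\<lambda>x. 1) \<in> L2 \<nu>"
  by (rule bounded_L2[of _ 1]) auto

text \<open>
  The function is even continuous: up to an additive constant, it is a matrix coefficient of the
  Koopman representation at the centred indicator of \<open>U\<close>.
\<close>
lemma borel_measurable_emeasure_translate_Int [measurable]:
  assumes U: "U \<in> sets \<nu>" and A: "A \<in> sets \<nu>"
  shows "(\<lambda>g. emeasure \<nu> (act (- g) -` U \<inter> A)) \<in> borel_measurable haar"
proof -
  note [measurable] = U A
  define \<xi> :: "'x \<Rightarrow> complex" where "\<xi> = (\<lambda>x. of_real (indicator U x - prob U))"
  let ?D = "\<lambda>g h x. koopman act g \<xi> x - koopman act h \<xi> x"
  have [measurable]: "\<xi> \<in> borel_measurable \<nu>"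
    unfolding \<xi>_def by measurable
  have \<xi>_L2: "\<xi> \<in> L2 \<nu>"
  proof (rule bounded_L2)
    have "\<bar>indicator U x - prob U\<bar> \<le> 1" for x
      by (auto split: split_indicator)
    then show "cmod (\<xi> x) \<le> 1" for x
      unfolding \<xi>_def norm_of_real .
  qed measurable
  have "(\<integral>x. indicator U x - prob U \<partial>\<nu>) = 0"
    using U by (subst Bochner_Integration.integral_diff) (auto simp: integrable_indicator)
  then have "(\<integral>x. \<xi> x \<partial>\<nu>) = 0"
    unfolding \<xi>_def by (simp only: integral_complex_of_real of_real_0)
  then have \<xi>: "\<xi> \<in> L2_0 \<nu>"
    using \<xi>_L2 by (simp add: L2_0_def)
  have D: "?D g h \<in> L2 \<nu>" for g h
    by (intro L2_diff koopman_L2 \<xi>_L2)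
  have norm_one: "norm2 \<nu> (\<lambda>x. 1) = 1"
    by (simp add: norm2_def)
  have le: "\<bar>prob (act (- g) -` U \<inter> A) - prob (act (- h) -` U \<inter> A)\<bar> \<le> norm2 \<nu> (?D g h)" for g h
  proof -
    have "prob (act (- g) -` U \<inter> A) - prob (act (- h) -` U \<inter> A) =
        (\<integral>x. indicator (act (- g) -` U \<inter> A) x - indicator (act (- h) -` U \<inter> A) x \<partial>\<nu>)"
      by (subst Bochner_Integration.integral_diff) (auto simp: integrable_indicator)
    also have "\<bar>\<dots>\<bar> \<le> (\<integral>x. \<bar>indicator (act (- g) -` U \<inter> A) x - indicator (act (- h) -` U \<inter> A) x\<bar> \<partial>\<nu>)"
      by (rule integral_abs_bound)
    also have "\<dots> \<le> (\<integral>x. cmod (?D g h x) * cmod 1 \<partial>\<nu>)"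
    proof (rule integral_mono)
      show "integrable \<nu> (\<lambda>x. cmod (?D g h x) * cmod 1)"
        by (rule L2_integrable_cmod_mult[OF D one_L2])
      have "?D g h x = of_real (indicator U (act (- g) x) - indicator U (act (- h) x))" for x
        by (simp add: koopman_def \<xi>_def)
      then have "cmod (?D g h x) = \<bar>indicator U (act (- g) x) - indicator U (act (- h) x)\<bar>" for x
        by (simp only: norm_of_real)
      then show "\<bar>indicator (act (- g) -` U \<inter> A) x - indicator (act (- h) -` U \<inter> A) x\<bar> \<le>
          cmod (?D g h x) * cmod 1" for x
        by (auto simp: indicator_def)
      show "integrable \<nu> (\<lambda>x. \<bar>indicator (act (- g) -` U \<inter> A) x - indicator (act (- h) -` U \<inter> A) x\<bar> :: real)"
        by (intro Bochner_Integration.integrable_abs Bochner_Integration.integrable_diff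
            integrable_indicator) auto
    qed
    also have "\<dots> \<le> norm2 \<nu> (?D g h)"
      using integral_cmod_mult_le[OF D one_L2] by (simp add: norm_one)
    finally show ?thesis .
  qed
  have "((\<lambda>g. prob (act (- g) -` U \<inter> A)) \<longlongrightarrow> prob (act (- h) -` U \<inter> A)) (at h)" for h
  proof -
    have "((\<lambda>g. norm2 \<nu> (?D g h)) \<longlongrightarrow> 0) (at h)"
      using koopman_continuous \<xi> by (simp add: strongly_continuous_def)
    then have "((\<lambda>g. prob (act (- g) -` U \<inter> A) - prob (act (- h) -` U \<inter> A)) \<longlongrightarrow> 0) (at h)"
      by (rule Lim_null_comparison[rotated]) (use le in auto)
    then show ?thesis
      by (simp add: LIM_zero_iff)
  qed
  then have "continuous_on UNIV (\<lambda>g. prob (act (- g) -` U \<inter> A))"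
    by (simp add: continuous_on_def)
  then have "(\<lambda>g. prob (act (- g) -` U \<inter> A)) \<in> borel_measurable haar"
    using borel_measurable_continuous_onI sets_haar by (simp cong: measurable_cong_sets)
  then show ?thesis
    by (simp add: emeasure_eq_measure)
qed


section \<open>Spreading a weight on the group along translates of a set\<close>

text \<open>
  Morally \<open>spread U w x\<close> is \<open>\<integral> w(g) 1\<^bsub>gU\<^esub>(x) dg\<close>. The monadic bind builds the measure
  \<open>A \<mapsto> \<integral> w(g) \<nu>(gU \<inter> A) dg\<close> without any joint measurability in \<open>g\<close> and \<open>x\<close>. Below, the translate
  \<open>gU\<close> is always written as the preimage of \<open>U\<close> under the action of \<open>- g\<close>.
\<close>
definition spread :: "'x set \<Rightarrow> ('g \<Rightarrow> ennreal) \<Rightarrow> 'x \<Rightarrow> ennreal" where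
  "spread U w = RN_deriv \<nu> (density haar w \<bind> (\<lambda>g. density \<nu> (indicator (act (- g) -` U))))"

lemma borel_measurable_spread [measurable]: "spread U w \<in> borel_measurable \<nu>"
  by (simp add: spread_def)

lemma nn_integral_spread:
  assumes U: "U \<in> sets \<nu>" and w: "w \<in> borel_measurable haar" and A: "A \<in> sets \<nu>"
  shows "(\<integral>\<^sup>+x. spread U w x * indicator A x \<partial>\<nu>) =
    (\<integral>\<^sup>+g. w g * emeasure \<nu> (act (- g) -` U \<inter> A) \<partial>haar)"
proof -
  note [measurable] = U w
  define K where "K = (\<lambda>g. density \<nu> (indicator (act (- g) -` U)))"
  define \<kappa> where "\<kappa> = density haar w \<bind> K"
  have K_emeasure: "emeasure (K g) B = emeasure \<nu> (act (- g) -` U \<inter> B)" if "B \<in> sets \<nu>" for g B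
    unfolding K_def using that U
    by (subst emeasure_density) (auto simp flip: indicator_inter_arith nn_integral_indicator)
  have K: "K \<in> measurable (density haar w) (subprob_algebra \<nu>)"
  proof (rule measurable_subprob_algebra)
    fix g
    show "subprob_space (K g)"
    proof
      show "emeasure (K g) (space (K g)) \<le> 1"
        using K_emeasure[of UNIV g] emeasure_le_1 by (simp add: K_def)
    qed (simp add: K_def)
    show "sets (K g) = sets \<nu>"
      by (simp add: K_def)
  next
    fix B assume "B \<in> sets \<nu>"
    then show "(\<lambda>g. emeasure (K g) B) \<in> borel_measurable (density haar w)"
      using U by (simp add: K_emeasure borel_measurable_emeasure_translate_Int)
  qed
  have sets_\<kappa>: "sets \<kappa> = sets \<nu>"
    unfolding \<kappa>_def by (rule sets_bind) (auto simp: K_def)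
  have \<kappa>: "emeasure \<kappa> B = (\<integral>\<^sup>+g. w g * emeasure \<nu> (act (- g) -` U \<inter> B) \<partial>haar)" if "B \<in> sets \<nu>" for B
    unfolding \<kappa>_def using U w that
    by (subst emeasure_bind[OF _ K]) (auto simp: K_emeasure nn_integral_density)
  have "absolutely_continuous \<nu> \<kappa>"
    unfolding absolutely_continuous_def
  proof
    fix B assume B: "B \<in> null_sets \<nu>"
    have "emeasure \<nu> (act (- g) -` U \<inter> B) = 0" for g
      by (rule emeasure_eq_0[of B]) (use B in auto)
    then show "B \<in> null_sets \<kappa>"
      using B \<kappa>[of B] sets_\<kappa> by auto
  qed
  then have "density \<nu> (spread U w) = \<kappa>"
    unfolding spread_def K_def[symmetric] \<kappa>_def[symmetric] by (intro density_RN_deriv sets_\<kappa>)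
  then show ?thesis
    using \<kappa>[OF A] emeasure_density[of "spread U w" \<nu> A] A by simp
qed

lemma spread_eqI:
  assumes U: "U \<in> sets \<nu>" and w: "w \<in> borel_measurable haar" and p: "p \<in> borel_measurable \<nu>"
    and eq: "\<And>A. A \<in> sets \<nu> \<Longrightarrow> (\<integral>\<^sup>+x. p x * indicator A x \<partial>\<nu>) =
      (\<integral>\<^sup>+g. w g * emeasure \<nu> (act (- g) -` U \<inter> A) \<partial>haar)"
  shows "AE x in \<nu>. spread U w x = p x"
  using p by (intro density_unique_finite_measure) (auto simp: eq nn_integral_spread[OF U w])

lemma spread_add:
  assumes U: "U \<in> sets \<nu>" and w: "w \<in> borel_measurable haar" "w' \<in> borel_measurable haar"
  shows "AE x in \<nu>. spread U (\<lambda>g. w g + w' g) x = spread U w x + spread U w' x"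
proof (rule spread_eqI[OF U])
  fix A assume A: "A \<in> sets \<nu>"
  note [measurable] = w borel_measurable_emeasure_translate_Int[OF U A]
  show "(\<integral>\<^sup>+x. (spread U w x + spread U w' x) * indicator A x \<partial>\<nu>) =
      (\<integral>\<^sup>+g. (w g + w' g) * emeasure \<nu> (act (- g) -` U \<inter> A) \<partial>haar)"
    using A by (simp add: distrib_right nn_integral_add nn_integral_spread[OF U _ A])
qed (use w in auto)

lemma spread_cmult:
  assumes U: "U \<in> sets \<nu>" and w: "w \<in> borel_measurable haar"
  shows "AE x in \<nu>. spread U (\<lambda>g. c * w g) x = c * spread U w x"
proof (rule spread_eqI[OF U])
  fix A assume A: "A \<in> sets \<nu>"
  note [measurable] = w borel_measurable_emeasure_translate_Int[OF U A]
  show "(\<integral>\<^sup>+x. (c * spread U w x) * indicator A x \<partial>\<nu>) =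
      (\<integral>\<^sup>+g. (c * w g) * emeasure \<nu> (act (- g) -` U \<inter> A) \<partial>haar)"
    using A by (simp add: mult.assoc nn_integral_cmult nn_integral_spread[OF U w A])
qed (use w in auto)

text \<open>
  Equivariance: substituting \<open>s + g\<close> for \<open>g\<close> in the defining integral, which uses left invariance
  of the Haar measure on one side and invariance of \<open>\<nu>\<close> on the other.
\<close>
lemma spread_act:
  assumes U: "U \<in> sets \<nu>" and w: "w \<in> borel_measurable haar"
  shows "AE x in \<nu>. spread U (\<lambda>g. w (- s + g)) x = spread U w (act (- s) x)"
proof (rule spread_eqI[OF U])
  show "(\<lambda>g. w (- s + g)) \<in> borel_measurable haar"
    by (rule measurable_compose[OF measurable_translate w])
  show "(\<lambda>x. spread U w (act (- s) x)) \<in> borel_measurable \<nu>"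
    by (rule measurable_compose[OF measurable_act]) simp
  fix A assume A: "A \<in> sets \<nu>"
  have A': "act s -` A \<in> sets \<nu>"
    using A by measurable
  have "(\<integral>\<^sup>+x. spread U w (act (- s) x) * indicator A x \<partial>\<nu>) =
      (\<integral>\<^sup>+x. spread U w (act (- s) x) * indicator (act s -` A) (act (- s) x) \<partial>\<nu>)"
    by (simp add: indicator_def)
  also have "\<dots> = (\<integral>\<^sup>+x. spread U w x * indicator (act s -` A) x \<partial>\<nu>)"
    using A' by (intro nn_integral_act[of "\<lambda>x. spread U w x * indicator (act s -` A) x"]) auto
  also have "\<dots> = (\<integral>\<^sup>+g. w g * emeasure \<nu> (act (- g) -` U \<inter> act s -` A) \<partial>haar)"
    by (rule nn_integral_spread[OF U w A'])
  also have "\<dots> = (\<integral>\<^sup>+g. w (- s + (s + g)) * emeasure \<nu> (act (- (s + g)) -` U \<inter> A) \<partial>haar)"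
  proof (rule nn_integral_cong)
    fix g
    have "emeasure \<nu> (act s -` (act (- (s + g)) -` U \<inter> A)) = emeasure \<nu> (act (- (s + g)) -` U \<inter> A)"
      using U A by (intro emeasure_vimage_act) auto
    moreover have "act s -` (act (- (s + g)) -` U \<inter> A) = act (- g) -` U \<inter> act s -` A"
      by (auto simp: act_act minus_add add.assoc)
    ultimately show "w g * emeasure \<nu> (act (- g) -` U \<inter> act s -` A) =
        w (- s + (s + g)) * emeasure \<nu> (act (- (s + g)) -` U \<inter> A)"
      by (simp add: add.assoc[symmetric])
  qed
  also have "\<dots> = (\<integral>\<^sup>+g. w (- s + g) * emeasure \<nu> (act (- g) -` U \<inter> A) \<partial>haar)"
    using measurable_compose[OF measurable_translate w] borel_measurable_emeasure_translate_Int[OF U A]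
    by (intro nn_integral_translate[of "\<lambda>g. w (- s + g) * emeasure \<nu> (act (- g) -` U \<inter> A)"]) auto
  finally show "(\<integral>\<^sup>+x. spread U w (act (- s) x) * indicator A x \<partial>\<nu>) =
      (\<integral>\<^sup>+g. w (- s + g) * emeasure \<nu> (act (- g) -` U \<inter> A) \<partial>haar)" .
qed

end

text \<open>
  The infimum of \<open>t a + b / t\<close> over \<open>t > 0\<close> is \<open>2 \<surd>(a b)\<close>. Rational \<open>t\<close> suffice by density, and
  countability of the rationals allows one exceptional null set for all \<open>t\<close> at once.
\<close>
lemma le_sqrt_mult_of_weighted_bounds:
  fixes r a b :: real
  assumes "a \<ge> 0" "b \<ge> 0"
    and le: "\<And>t. t \<in> \<rat> \<Longrightarrow> t > 0 \<Longrightarrow> 2 * r \<le> t * a + b / t"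
  shows "r \<le> sqrt a * sqrt b"
proof -
  \<comment> \<open>Adding \<open>\<delta>\<close> to \<open>a\<close> and \<open>b\<close> makes the optimal weight \<open>q / p\<close> positive and finite, and
    leaves room for a rational weight next to it.\<close>
  have "2 * r \<le> (2 + \<delta>) * (sqrt (a + \<delta>) * sqrt (b + \<delta>))" if \<delta>: "\<delta> > 0" for \<delta>
  proof -
    define p q where "p = sqrt (a + \<delta>)" and "q = sqrt (b + \<delta>)"
    have pq: "p > 0" "q > 0" "p\<^sup>2 = a + \<delta>" "q\<^sup>2 = b + \<delta>"
      using assms(1,2) \<delta> by (auto simp: p_def q_def)
    have "q / p < (1 + \<delta>) * (q / p)"
      using pq \<delta> by (simp add: field_simps)
    then obtain t where t: "t \<in> \<rat>" "q / p < t" "t < (1 + \<delta>) * (q / p)"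
      using Rats_dense_in_real by blast
    have tpos: "t > 0"
      using t(2) pq by (meson divide_pos_pos less_trans)
    have "t * a \<le> ((1 + \<delta>) * (q / p)) * p\<^sup>2"
      using t(3) tpos \<delta> assms(1) pq by (intro mult_mono) auto
    also have "\<dots> = (1 + \<delta>) * (p * q)"
      using pq(1) by (simp add: power2_eq_square)
    finally have 1: "t * a \<le> (1 + \<delta>) * (p * q)" .
    have "b / t \<le> q\<^sup>2 / (q / p)"
      using t(2) tpos pq \<delta> assms(2) by (intro frac_le) auto
    also have "\<dots> = p * q"
      using pq(1,2) by (simp add: power2_eq_square)
    finally have 2: "b / t \<le> p * q" .
    show ?thesis
      using le[OF t(1) tpos] 1 2 unfolding p_def[symmetric] q_def[symmetric]
      by (simp add: algebra_simps)
  qed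
  then have "\<forall>\<^sub>F \<delta> in at_right 0. 2 * r \<le> (2 + \<delta>) * (sqrt (a + \<delta>) * sqrt (b + \<delta>))"
    by (intro eventually_at_rightI[of 0 1]) auto
  moreover have "((\<lambda>\<delta>. (2 + \<delta>) * (sqrt (a + \<delta>) * sqrt (b + \<delta>))) \<longlongrightarrow>
      (2 + 0) * (sqrt (a + 0) * sqrt (b + 0))) (at_right 0)"
    by (intro tendsto_intros)
  ultimately have "2 * r \<le> (2 + 0) * (sqrt (a + 0) * sqrt (b + 0))"
    by (intro tendsto_lowerbound) auto
  then show ?thesis
    by simp
qed

context koopman_action
begin

lemma nn_integral_spread_UNIV:
  assumes U: "U \<in> sets \<nu>" and w: "w \<in> borel_measurable haar"
  shows "(\<integral>\<^sup>+x. spread U w x \<partial>\<nu>) = emeasure \<nu> U * (\<integral>\<^sup>+g. w g \<partial>haar)"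
  using nn_integral_spread[OF U w UNIV_sets_\<nu>] w
  by (simp add: emeasure_vimage_act[OF U] nn_integral_multc mult.commute)

text \<open>
  The Cauchy--Schwarz inequality for the integral that \<open>spread\<close> replaces. As densities are only
  determined almost everywhere and only their linearity is available, it is obtained from the
  inequalities \<open>2 f h \<le> t f\<^sup>2 + h\<^sup>2 / t\<close>, which pass to densities for each \<open>t\<close> separately.
\<close>
lemma spread_mult_le:
  assumes U: "U \<in> sets \<nu>"
    and f [measurable]: "f \<in> borel_measurable haar" and h [measurable]: "h \<in> borel_measurable haar"
    and nonneg: "\<And>g. f g \<ge> 0" "\<And>g. h g \<ge> 0"
  shows "AE x in \<nu>. spread U (\<lambda>g. ennreal ((f g)\<^sup>2)) x < \<infinity> \<longrightarrow> spread U (\<lambda>g. ennreal ((h g)\<^sup>2)) x < \<infinity> \<longrightarrow>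
    spread U (\<lambda>g. ennreal (f g * h g)) x \<le>
      ennreal (sqrt (enn2real (spread U (\<lambda>g. ennreal ((f g)\<^sup>2)) x)) *
        sqrt (enn2real (spread U (\<lambda>g. ennreal ((h g)\<^sup>2)) x)))"
    (is "AE x in \<nu>. ?p x < \<infinity> \<longrightarrow> ?q x < \<infinity> \<longrightarrow> ?r x \<le> _")
proof -
  have weighted: "AE x in \<nu>. ennreal 2 * ?r x \<le> ennreal t * ?p x + ennreal (1 / t) * ?q x"
    if t: "t > 0" for t :: real
  proof -
    \<comment> \<open>The defect in the weighted inequality, a perfect square. It makes the inequality an identity
      between sums of non-negative weights.\<close>
    define d where "d = (\<lambda>g. ennreal ((sqrt t * f g - h g / sqrt t)\<^sup>2))"
    have [measurable]: "d \<in> borel_measurable haar"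
      unfolding d_def by measurable
    have "(\<lambda>g. ennreal t * ennreal ((f g)\<^sup>2) + ennreal (1 / t) * ennreal ((h g)\<^sup>2)) =
        (\<lambda>g. ennreal 2 * ennreal (f g * h g) + d g)"
    proof
      fix g
      have "t * (f g)\<^sup>2 + 1 / t * (h g)\<^sup>2 = 2 * (f g * h g) + (sqrt t * f g - h g / sqrt t)\<^sup>2"
        using t by (simp add: power2_diff power_mult_distrib power_divide)
      then show "ennreal t * ennreal ((f g)\<^sup>2) + ennreal (1 / t) * ennreal ((h g)\<^sup>2) =
          ennreal 2 * ennreal (f g * h g) + d g"
        using t nonneg unfolding d_def
        by (simp only: ennreal_mult[symmetric] ennreal_plus[symmetric] zero_le_power2
            mult_nonneg_nonneg zero_le_numeral divide_nonneg_nonneg zero_le_one less_imp_le)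
    qed
    moreover have "AE x in \<nu>. spread U (\<lambda>g. ennreal t * ennreal ((f g)\<^sup>2) + ennreal (1 / t) * ennreal ((h g)\<^sup>2)) x =
        spread U (\<lambda>g. ennreal t * ennreal ((f g)\<^sup>2)) x + spread U (\<lambda>g. ennreal (1 / t) * ennreal ((h g)\<^sup>2)) x"
      by (rule spread_add[OF U]) measurable
    moreover have "AE x in \<nu>. spread U (\<lambda>g. ennreal t * ennreal ((f g)\<^sup>2)) x = ennreal t * ?p x"
      by (rule spread_cmult[OF U]) measurable
    moreover have "AE x in \<nu>. spread U (\<lambda>g. ennreal (1 / t) * ennreal ((h g)\<^sup>2)) x = ennreal (1 / t) * ?q x"
      by (rule spread_cmult[OF U]) measurable
    moreover have "AE x in \<nu>. spread U (\<lambda>g. ennreal 2 * ennreal (f g * h g) + d g) x =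
        spread U (\<lambda>g. ennreal 2 * ennreal (f g * h g)) x + spread U d x"
      by (rule spread_add[OF U]) measurable
    moreover have "AE x in \<nu>. spread U (\<lambda>g. ennreal 2 * ennreal (f g * h g)) x = ennreal 2 * ?r x"
      by (rule spread_cmult[OF U]) measurable
    ultimately show ?thesis
      by (elim AE_mp) (auto intro!: AE_I2)
  qed
  have "AE x in \<nu>. \<forall>t\<in>\<rat> \<inter> {0<..}. ennreal 2 * ?r x \<le> ennreal t * ?p x + ennreal (1 / t) * ?q x"
    using weighted by (subst AE_ball_countable) (auto intro: countable_rat)
  then show ?thesis
  proof eventually_elim
    fix x
    assume le: "\<forall>t\<in>\<rat> \<inter> {0<..}. ennreal 2 * ?r x \<le> ennreal t * ?p x + ennreal (1 / t) * ?q x"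
    show "?p x < \<infinity> \<longrightarrow> ?q x < \<infinity> \<longrightarrow> ?r x \<le> ennreal (sqrt (enn2real (?p x)) * sqrt (enn2real (?q x)))"
    proof (intro impI)
      assume fin: "?p x < \<infinity>" "?q x < \<infinity>"
      define a b where "a = enn2real (?p x)" and "b = enn2real (?q x)"
      have ab: "?p x = ennreal a" "?q x = ennreal b" "a \<ge> 0" "b \<ge> 0"
        using fin by (auto simp: a_def b_def)
      have le': "ennreal 2 * ?r x \<le> ennreal (t * a + b / t)" if "t \<in> \<rat>" "t > 0" for t
      proof -
        have "ennreal 2 * ?r x \<le> ennreal t * ?p x + ennreal (1 / t) * ?q x"
          using le that by auto
        then show ?thesis
          using that ab by (simp add: ennreal_mult'[symmetric])
      qed
      have "ennreal 2 * ?r x < \<infinity>"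
        using le'[of 1] by (auto intro: le_less_trans)
      then have "?r x < \<infinity>"
        by (auto simp: ennreal_mult_less_top)
      then obtain r where r: "?r x = ennreal r" "r \<ge> 0"
        by (cases "?r x") auto
      have "r \<le> sqrt a * sqrt b"
      proof (rule le_sqrt_mult_of_weighted_bounds[OF ab(3,4)])
        fix t :: real assume t: "t \<in> \<rat>" "t > 0"
        have "ennreal (2 * r) \<le> ennreal (t * a + b / t)"
          using le'[OF t] r by (simp add: ennreal_mult')
        then show "2 * r \<le> t * a + b / t"
          using ab t by (subst (asm) ennreal_le_iff) auto
      qed
      then show "?r x \<le> ennreal (sqrt (enn2real (?p x)) * sqrt (enn2real (?q x)))"
        unfolding r(1) a_def[symmetric] b_def[symmetric] by (rule ennreal_leI)
    qed
  qed
qed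


section \<open>Transplanting square-integrable functions from the group to the space\<close>

text \<open>
  Only the modulus of \<open>f\<close> is transplanted; this loses nothing, since \<open>\<mu>\<close> is a positive measure.
\<close>
definition transplant :: "'x set \<Rightarrow> ('g \<Rightarrow> complex) \<Rightarrow> 'x \<Rightarrow> real" where
  "transplant U f x = sqrt (enn2real (spread U (\<lambda>g. ennreal ((cmod (f g))\<^sup>2)) x))"

lemma transplant_nonneg [simp]: "transplant U f x \<ge> 0"
  by (simp add: transplant_def)

lemma borel_measurable_transplant [measurable]: "transplant U f \<in> borel_measurable \<nu>"
  unfolding transplant_def by measurable

lemma transplant_finite:
  assumes U: "U \<in> sets \<nu>" and f: "f \<in> L2 haar"
  shows "AE x in \<nu>. spread U (\<lambda>g. ennreal ((cmod (f g))\<^sup>2)) x < \<infinity>"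
proof -
  have "(\<integral>\<^sup>+x. spread U (\<lambda>g. ennreal ((cmod (f g))\<^sup>2)) x \<partial>\<nu>) \<noteq> \<infinity>"
    using f by (subst nn_integral_spread_UNIV[OF U])
      (auto simp: L2_def nn_integral_cmod_power2[OF f] ennreal_mult_eq_top_iff)
  then have "AE x in \<nu>. spread U (\<lambda>g. ennreal ((cmod (f g))\<^sup>2)) x \<noteq> \<infinity>"
    by (intro nn_integral_PInf_AE) auto
  then show ?thesis
    by (auto simp: less_top)
qed

lemma transplant_L2:
  assumes U: "U \<in> sets \<nu>" and f: "f \<in> L2 haar"
  shows "(\<lambda>x. complex_of_real (transplant U f x)) \<in> L2 \<nu>"
    and "norm2 \<nu> (\<lambda>x. complex_of_real (transplant U f x)) = sqrt (prob U) * norm2 haar f"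
proof -
  have "AE x in \<nu>. ennreal ((cmod (complex_of_real (transplant U f x)))\<^sup>2) = spread U (\<lambda>g. ennreal ((cmod (f g))\<^sup>2)) x"
    using transplant_finite[OF U f] by eventually_elim (simp add: transplant_def)
  then have "(\<integral>\<^sup>+x. ennreal ((cmod (complex_of_real (transplant U f x)))\<^sup>2) \<partial>\<nu>) =
      (\<integral>\<^sup>+x. spread U (\<lambda>g. ennreal ((cmod (f g))\<^sup>2)) x \<partial>\<nu>)"
    by (rule nn_integral_cong_AE)
  also have "\<dots> = emeasure \<nu> U * (\<integral>\<^sup>+g. ennreal ((cmod (f g))\<^sup>2) \<partial>haar)"
    using f by (intro nn_integral_spread_UNIV[OF U]) (auto simp: L2_def)
  also have "\<dots> = ennreal (prob U * (norm2 haar f)\<^sup>2)"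
    by (simp add: nn_integral_cmod_power2[OF f] emeasure_eq_measure ennreal_mult)
  finally have eq: "(\<integral>\<^sup>+x. ennreal ((cmod (complex_of_real (transplant U f x)))\<^sup>2) \<partial>\<nu>) =
      ennreal (prob U * (norm2 haar f)\<^sup>2)" .
  then have "integrable \<nu> (\<lambda>x. (cmod (complex_of_real (transplant U f x)))\<^sup>2)"
    by (intro integrableI_nn_integral_finite) auto
  then show L2: "(\<lambda>x. complex_of_real (transplant U f x)) \<in> L2 \<nu>"
    by (auto simp: L2_def)
  have "(norm2 \<nu> (\<lambda>x. complex_of_real (transplant U f x)))\<^sup>2 = prob U * (norm2 haar f)\<^sup>2"
    using eq unfolding nn_integral_cmod_power2[OF L2] by (subst (asm) ennreal_inj) auto
  also have "\<dots> = (sqrt (prob U) * norm2 haar f)\<^sup>2"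
    by (simp add: power_mult_distrib)
  finally show "norm2 \<nu> (\<lambda>x. complex_of_real (transplant U f x)) = sqrt (prob U) * norm2 haar f"
    by (rule power2_eq_imp_eq) auto
qed

lemma transplant_eq_0_outside:
  assumes U: "U \<in> sets \<nu>" and f: "f \<in> L2 haar" and V: "V \<in> sets \<nu>"
    and supp: "\<And>g x. f g \<noteq> 0 \<Longrightarrow> act (- g) x \<in> U \<Longrightarrow> x \<in> V"
  shows "AE x in \<nu>. x \<notin> V \<longrightarrow> transplant U f x = 0"
proof -
  have V': "- V \<in> sets \<nu>"
    using sets.compl_sets[OF V] by (simp add: Compl_eq_Diff_UNIV)
  have "(\<integral>\<^sup>+x. spread U (\<lambda>g. ennreal ((cmod (f g))\<^sup>2)) x * indicator (- V) x \<partial>\<nu>) =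
      (\<integral>\<^sup>+g. ennreal ((cmod (f g))\<^sup>2) * emeasure \<nu> (act (- g) -` U \<inter> - V) \<partial>haar)"
    using f by (intro nn_integral_spread[OF U _ V']) (auto simp: L2_def)
  also have "\<dots> = (\<integral>\<^sup>+g. 0 \<partial>haar)"
  proof (rule nn_integral_cong)
    fix g
    have "act (- g) -` U \<inter> - V = {}" if "f g \<noteq> 0"
      using supp[OF that] by auto
    then show "ennreal ((cmod (f g))\<^sup>2) * emeasure \<nu> (act (- g) -` U \<inter> - V) = 0"
      by (cases "f g = 0") simp_all
  qed
  finally have "AE x in \<nu>. spread U (\<lambda>g. ennreal ((cmod (f g))\<^sup>2)) x * indicator (- V) x = 0"
    using V' by (subst nn_integral_0_iff_AE[symmetric]) auto
  then show ?thesis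
    by eventually_elim (auto simp: transplant_def indicator_def)
qed

lemma integrable_transplant:
  assumes U: "U \<in> sets \<nu>" and f: "f \<in> L2 haar"
  shows "integrable \<nu> (transplant U f)"
  using L2_integrable_cmod_mult[OF transplant_L2(1)[OF U f] one_L2] by simp

text \<open>
  A transplanted function is nearly orthogonal to the constants if it lives on a set of small
  measure, by the Cauchy--Schwarz inequality against the indicator of that set.
\<close>
lemma integral_transplant_le:
  assumes U: "U \<in> sets \<nu>" and f: "f \<in> L2 haar" and V: "V \<in> sets \<nu>"
    and supp: "\<And>g x. f g \<noteq> 0 \<Longrightarrow> act (- g) x \<in> U \<Longrightarrow> x \<in> V"
  shows "(\<integral>x. transplant U f x \<partial>\<nu>) \<le> sqrt (prob V) * (sqrt (prob U) * norm2 haar f)"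
proof -
  define i :: "'x \<Rightarrow> complex" where "i = indicator V"
  have i: "i \<in> L2 \<nu>"
    using V by (intro bounded_L2[of _ 1]) (auto simp: i_def split: split_indicator)
  have "(\<integral>x. (cmod (i x))\<^sup>2 \<partial>\<nu>) = (\<integral>x. indicator V x \<partial>\<nu>)"
    by (intro Bochner_Integration.integral_cong) (auto simp: i_def split: split_indicator)
  then have norm_i: "norm2 \<nu> i = sqrt (prob V)"
    by (simp add: norm2_def)
  have meas: "(\<lambda>x. cmod (complex_of_real (transplant U f x)) * cmod (i x)) \<in> borel_measurable \<nu>"
    using L2_integrable_cmod_mult[OF transplant_L2(1)[OF U f] i] by (rule borel_measurable_integrable)
  have "(\<integral>x. transplant U f x \<partial>\<nu>) = (\<integral>x. cmod (complex_of_real (transplant U f x)) * cmod (i x) \<partial>\<nu>)"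
  proof (rule integral_cong_AE[OF borel_measurable_transplant meas])
    show "AE x in \<nu>. transplant U f x = cmod (complex_of_real (transplant U f x)) * cmod (i x)"
      using transplant_eq_0_outside[of U f V] U f V supp
      by (auto simp: i_def indicator_def elim!: AE_mp)
  qed
  also have "\<dots> \<le> norm2 \<nu> (\<lambda>x. complex_of_real (transplant U f x)) * norm2 \<nu> i"
    by (rule integral_cmod_mult_le[OF transplant_L2(1)[OF U f] i])
  finally show ?thesis
    by (simp add: transplant_L2(2)[OF U f] norm_i mult.commute)
qed

lemma transplant_left_regular:
  assumes U: "U \<in> sets \<nu>" and f: "f \<in> L2 haar"
  shows "AE x in \<nu>. transplant U (left_regular s f) x = transplant U f (act (- s) x)"
  using spread_act[OF U, of "\<lambda>g. ennreal ((cmod (f g))\<^sup>2)" s] f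
  by (auto simp: L2_def transplant_def left_regular_def)

text \<open>
  The inequality that carries the proof. It holds for every \<open>s\<close> and every measurable \<open>U\<close>, but
  concerns the Koopman representation on all of \<open>L\<^sup>2\<close>, where it says little by itself: the constant
  functions already make the operator norm of \<open>\<pi>(\<mu>)\<close> as large as \<open>\<mu>(G)\<close>.
\<close>
lemma left_regular_le_koopman_transplant:
  assumes U: "U \<in> sets \<nu>" and f: "f \<in> L2 haar" and h: "h \<in> L2 haar"
  shows "prob U * cmod (inner2 haar (left_regular s f) h) \<le>
    (\<integral>x. transplant U f (act (- s) x) * transplant U h x \<partial>\<nu>)"
proof -
  let ?F = "transplant U f" and ?H = "transplant U h" and ?f = "left_regular s f"
  have sf: "?f \<in> L2 haar"
    by (rule left_regular_L2[OF f])
  have meas: "?f \<in> borel_measurable haar" "h \<in> borel_measurable haar"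
    using sf h by (auto simp: L2_def)
  have "integrable \<nu> (\<lambda>x. cmod (koopman act s (\<lambda>x. complex_of_real (?F x)) x) * cmod (complex_of_real (?H x)))"
    by (intro L2_integrable_cmod_mult koopman_L2 transplant_L2 U f h)
  then have int: "integrable \<nu> (\<lambda>x. ?F (act (- s) x) * ?H x)"
    by (simp add: koopman_def)
  have "ennreal (prob U * (\<integral>g. cmod (?f g) * cmod (h g) \<partial>haar)) =
      emeasure \<nu> U * (\<integral>\<^sup>+g. ennreal (cmod (?f g) * cmod (h g)) \<partial>haar)"
    using L2_integrable_cmod_mult[OF sf h]
    by (subst nn_integral_eq_integral) (auto simp: emeasure_eq_measure ennreal_mult')
  also have "\<dots> = (\<integral>\<^sup>+x. spread U (\<lambda>g. ennreal (cmod (?f g) * cmod (h g))) x \<partial>\<nu>)"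
    using meas by (intro nn_integral_spread_UNIV[OF U, symmetric]) auto
  also have "\<dots> \<le> (\<integral>\<^sup>+x. ennreal (?F (act (- s) x) * ?H x) \<partial>\<nu>)"
  proof (rule nn_integral_mono_AE)
    have "AE x in \<nu>. spread U (\<lambda>g. ennreal ((cmod (?f g))\<^sup>2)) x < \<infinity> \<longrightarrow>
        spread U (\<lambda>g. ennreal ((cmod (h g))\<^sup>2)) x < \<infinity> \<longrightarrow>
        spread U (\<lambda>g. ennreal (cmod (?f g) * cmod (h g))) x \<le> ennreal (transplant U ?f x * ?H x)"
      unfolding transplant_def using meas by (intro spread_mult_le[OF U]) auto
    with transplant_finite[OF U sf] transplant_finite[OF U h] transplant_left_regular[OF U f, of s]
    show "AE x in \<nu>. spread U (\<lambda>g. ennreal (cmod (?f g) * cmod (h g))) x \<le> ennreal (?F (act (- s) x) * ?H x)"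
      by eventually_elim simp
  qed
  also have "\<dots> = ennreal (\<integral>x. ?F (act (- s) x) * ?H x \<partial>\<nu>)"
    using int by (intro nn_integral_eq_integral) auto
  finally have "prob U * (\<integral>g. cmod (?f g) * cmod (h g) \<partial>haar) \<le> (\<integral>x. ?F (act (- s) x) * ?H x \<partial>\<nu>)"
    by (subst (asm) ennreal_le_iff) (auto intro!: integral_nonneg)
  moreover have "prob U * cmod (inner2 haar ?f h) \<le> prob U * (\<integral>g. cmod (?f g) * cmod (h g) \<partial>haar)"
    by (intro mult_left_mono cmod_inner2_le_integral sf h) auto
  ultimately show ?thesis
    by linarith
qed


section \<open>Comparison of the integrated operators\<close>

lemma centered_L2_0:
  fixes F :: "'x \<Rightarrow> real"
  assumes F: "(\<lambda>x. complex_of_real (F x)) \<in> L2 \<nu>" and int: "integrable \<nu> F"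
  defines "m \<equiv> \<integral>x. F x \<partial>\<nu>"
  shows "(\<lambda>x. complex_of_real (F x - m)) \<in> L2_0 \<nu>"
    and "norm2 \<nu> (\<lambda>x. complex_of_real (F x - m)) \<le> norm2 \<nu> (\<lambda>x. complex_of_real (F x))"
proof -
  have "(\<lambda>x. complex_of_real (F x) - complex_of_real m * 1) \<in> L2 \<nu>"
    by (intro L2_diff F L2_scale one_L2)
  moreover have "(\<integral>x. F x - m \<partial>\<nu>) = 0"
    using int by (simp add: m_def)
  then have "(\<integral>x. complex_of_real (F x - m) \<partial>\<nu>) = 0"
    by (simp only: integral_complex_of_real of_real_0)
  ultimately show "(\<lambda>x. complex_of_real (F x - m)) \<in> L2_0 \<nu>"
    by (simp add: L2_0_def)
  have int2: "integrable \<nu> (\<lambda>x. (F x)\<^sup>2)"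
    using F by (simp add: L2_def)
  have "(\<integral>x. (F x - m)\<^sup>2 \<partial>\<nu>) = (\<integral>x. (F x)\<^sup>2 + m\<^sup>2 - 2 * m * F x \<partial>\<nu>)"
    by (intro Bochner_Integration.integral_cong) (auto simp: power2_diff)
  also have "\<dots> = (\<integral>x. (F x)\<^sup>2 \<partial>\<nu>) - m\<^sup>2"
    using int int2 by (simp add: m_def power2_eq_square)
  finally have "(\<integral>x. (F x - m)\<^sup>2 \<partial>\<nu>) \<le> (\<integral>x. (F x)\<^sup>2 \<partial>\<nu>)"
    by simp
  then show "norm2 \<nu> (\<lambda>x. complex_of_real (F x - m)) \<le> norm2 \<nu> (\<lambda>x. complex_of_real (F x))"
    unfolding norm2_def norm_of_real power2_abs by (rule real_sqrt_le_mono)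
qed

lemma inner2_koopman_centered:
  fixes F H :: "'x \<Rightarrow> real"
  assumes F: "(\<lambda>x. complex_of_real (F x)) \<in> L2 \<nu>" "integrable \<nu> F"
    and H: "(\<lambda>x. complex_of_real (H x)) \<in> L2 \<nu>" "integrable \<nu> H"
  defines "m \<equiv> \<integral>x. F x \<partial>\<nu>" and "m' \<equiv> \<integral>x. H x \<partial>\<nu>"
  shows "inner2 \<nu> (koopman act s (\<lambda>x. complex_of_real (F x - m))) (\<lambda>x. complex_of_real (H x - m')) =
    complex_of_real ((\<integral>x. F (act (- s) x) * H x \<partial>\<nu>) - m * m')"
proof -
  have "integrable \<nu> (\<lambda>x. koopman act s (\<lambda>x. complex_of_real (F x)) x * cnj (complex_of_real (H x)))"
    by (intro L2_integrable_mult_cnj koopman_L2 F H)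
  then have "integrable \<nu> (\<lambda>x. complex_of_real (F (act (- s) x) * H x))"
    by (simp add: koopman_def)
  then have int: "integrable \<nu> (\<lambda>x. F (act (- s) x) * H x)"
    by (simp only: complex_of_real_integrable_eq)
  have intF: "integrable \<nu> (\<lambda>x. F (act (- s) x))" "(\<integral>x. F (act (- s) x) \<partial>\<nu>) = m"
    using integrable_act[OF F(2)] integral_act[of F "- s"] F(2) by (auto simp: m_def)
  have "inner2 \<nu> (koopman act s (\<lambda>x. complex_of_real (F x - m))) (\<lambda>x. complex_of_real (H x - m')) =
      (\<integral>x. complex_of_real ((F (act (- s) x) - m) * (H x - m')) \<partial>\<nu>)"
    by (simp add: inner2_def koopman_def)
  also have "\<dots> = complex_of_real (\<integral>x. (F (act (- s) x) - m) * (H x - m') \<partial>\<nu>)"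
    by (rule integral_complex_of_real)
  also have "(\<integral>x. (F (act (- s) x) - m) * (H x - m') \<partial>\<nu>) =
      (\<integral>x. F (act (- s) x) * H x - m' * F (act (- s) x) - m * H x + m * m' \<partial>\<nu>)"
    by (intro Bochner_Integration.integral_cong) (auto simp: algebra_simps)
  also have "\<dots> = (\<integral>x. F (act (- s) x) * H x \<partial>\<nu>) - m * m'"
    using int intF H(2) by (simp add: m'_def[symmetric])
  finally show ?thesis .
qed

text \<open>
  The transplants of \<open>f\<close> and \<open>h\<close> are centred to bring them into \<open>L\<^sup>2\<^sub>0\<close>. The factor \<open>\<nu>(V)\<close> in the
  error is the product of the two factors \<open>\<surd>\<nu>(V)\<close> that bound their means.
\<close>
lemma cmod_inner2_integrated_le_of_small_support:
  assumes T: "is_integrated_operator \<nu> (L2_0 \<nu>) (koopman act) \<mu> T"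
    and S: "is_integrated_operator haar (L2 haar) left_regular \<mu> S"
    and \<mu>: "finite_measure \<mu>"
    and U: "U \<in> sets \<nu>" "prob U > 0" and V: "V \<in> sets \<nu>"
    and f: "f \<in> L2 haar" "\<And>g x. f g \<noteq> 0 \<Longrightarrow> act (- g) x \<in> U \<Longrightarrow> x \<in> V"
    and h: "h \<in> L2 haar" "\<And>g x. h g \<noteq> 0 \<Longrightarrow> act (- g) x \<in> U \<Longrightarrow> x \<in> V"
  shows "cmod (inner2 haar (S f) h) \<le>
    (operator_norm \<nu> (L2_0 \<nu>) T + prob V * measure \<mu> (space \<mu>)) * (norm2 haar f * norm2 haar h)"
proof -
  interpret \<mu>: finite_measure \<mu>
    by (rule \<mu>)
  define F where "F = transplant U f"
  define H where "H = transplant U h"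
  define m where "m = (\<integral>x. F x \<partial>\<nu>)"
  define m' where "m' = (\<integral>x. H x \<partial>\<nu>)"
  define F0 where "F0 = (\<lambda>x. complex_of_real (F x - m))"
  define H0 where "H0 = (\<lambda>x. complex_of_real (H x - m'))"
  define N where "N = operator_norm \<nu> (L2_0 \<nu>) T"
  define nn where "nn = norm2 haar f * norm2 haar h"
  note F = transplant_L2[OF U(1) f(1)] integrable_transplant[OF U(1) f(1)]
  note H = transplant_L2[OF U(1) h(1)] integrable_transplant[OF U(1) h(1)]
  have F0: "F0 \<in> L2_0 \<nu>" "norm2 \<nu> F0 \<le> sqrt (prob U) * norm2 haar f"
    using centered_L2_0[OF F(1,3)] F(2) by (auto simp: F0_def F_def m_def)
  have H0: "H0 \<in> L2_0 \<nu>" "norm2 \<nu> H0 \<le> sqrt (prob U) * norm2 haar h"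
    using centered_L2_0[OF H(1,3)] H(2) by (auto simp: H0_def H_def m'_def)
  have "m * m' \<le> (sqrt (prob V) * (sqrt (prob U) * norm2 haar f)) * (sqrt (prob V) * (sqrt (prob U) * norm2 haar h))"
    unfolding m_def m'_def F_def H_def
    by (intro mult_mono integral_transplant_le U V f h) (auto intro!: integral_nonneg)
  also have "\<dots> = (sqrt (prob V) * sqrt (prob V)) * (sqrt (prob U) * sqrt (prob U)) * nn"
    unfolding nn_def by (simp only: ac_simps)
  also have "\<dots> = prob V * prob U * nn"
    by simp
  finally have mm: "m * m' \<le> prob V * prob U * nn" .
  have pointwise: "prob U * cmod (inner2 haar (left_regular s f) h) \<le>
      Re (inner2 \<nu> (koopman act s F0) H0) + prob V * prob U * nn" for s
  proof -
    have "Re (inner2 \<nu> (koopman act s F0) H0) = (\<integral>x. F (act (- s) x) * H x \<partial>\<nu>) - m * m'"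
      unfolding F0_def H0_def m_def m'_def F_def H_def
      by (subst inner2_koopman_centered[OF F(1,3) H(1,3)]) simp
    then show ?thesis
      using left_regular_le_koopman_transplant[OF U(1) f(1) h(1), of s] mm by (simp add: F_def H_def)
  qed
  have intS: "integrable \<mu> (\<lambda>s. inner2 haar (left_regular s f) h)"
      "inner2 haar (S f) h = (\<integral>s. inner2 haar (left_regular s f) h \<partial>\<mu>)"
    using S f(1) h(1) by (auto simp: is_integrated_operator_def)
  have intT: "integrable \<mu> (\<lambda>s. inner2 \<nu> (koopman act s F0) H0)"
      "inner2 \<nu> (T F0) H0 = (\<integral>s. inner2 \<nu> (koopman act s F0) H0 \<partial>\<mu>)"
    using T F0(1) H0(1) by (auto simp: is_integrated_operator_def)
  have TF0: "T F0 \<in> L2 \<nu>" "F0 \<in> L2 \<nu>" "H0 \<in> L2 \<nu>"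
    using T F0(1) H0(1) by (auto simp: is_integrated_operator_def bounded_operator_def L2_0_def)
  have T_bounded: "bounded_operator \<nu> (L2_0 \<nu>) T"
    using T by (simp add: is_integrated_operator_def)
  then have TN: "norm2 \<nu> (T F0) \<le> N * norm2 \<nu> F0"
    unfolding N_def by (rule norm2_le_operator_norm[OF _ L2_0_subset_L2 L2_0_scale F0(1)])
  have N: "N \<ge> 0"
    unfolding N_def by (rule operator_norm_nonneg[OF T_bounded zero_L2_0])
  have "prob U * cmod (inner2 haar (S f) h) \<le> prob U * (\<integral>s. cmod (inner2 haar (left_regular s f) h) \<partial>\<mu>)"
    unfolding intS(2) by (intro mult_left_mono integral_norm_bound) auto
  also have "\<dots> = (\<integral>s. prob U * cmod (inner2 haar (left_regular s f) h) \<partial>\<mu>)"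
    by simp
  also have "\<dots> \<le> (\<integral>s. Re (inner2 \<nu> (koopman act s F0) H0) + prob V * prob U * nn \<partial>\<mu>)"
    using intS(1) intT(1) pointwise
    by (intro integral_mono Bochner_Integration.integrable_add integrable_mult_right integrable_Re
        integrable_norm \<mu>.integrable_const) auto
  also have "\<dots> = Re (inner2 \<nu> (T F0) H0) + prob V * prob U * nn * measure \<mu> (space \<mu>)"
    using intT by (simp add: integral_Re)
  also have "Re (inner2 \<nu> (T F0) H0) \<le> N * prob U * nn"
  proof -
    have "Re (inner2 \<nu> (T F0) H0) \<le> norm2 \<nu> (T F0) * norm2 \<nu> H0"
      using complex_Re_le_cmod cmod_inner2_le[OF TF0(1,3)] by (rule order.trans)
    also have "\<dots> \<le> (N * (sqrt (prob U) * norm2 haar f)) * (sqrt (prob U) * norm2 haar h)"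
      using TN mult_left_mono[OF F0(2) N] N H0(2)
      by (intro mult_mono) (auto intro: order.trans)
    also have "\<dots> = N * (sqrt (prob U) * sqrt (prob U)) * nn"
      unfolding nn_def by (simp only: ac_simps)
    also have "\<dots> = N * prob U * nn"
      by simp
    finally show ?thesis .
  qed
  finally have "prob U * cmod (inner2 haar (S f) h) \<le> prob U * ((N + prob V * measure \<mu> (space \<mu>)) * nn)"
    by (simp add: algebra_simps)
  then show ?thesis
    using U(2) unfolding N_def nn_def by simp
qed

text \<open>The tube lemma for the action map, with the conclusion \<open>K U \<subseteq> V\<close> written in terms of preimages.\<close>
lemma exists_neighbourhood_compact_translates:
  assumes K: "compact K" and V: "open V" "(\<lambda>g. act g x) ` K \<subseteq> V"
  shows "\<exists>U. open U \<and> x \<in> U \<and> (\<forall>g y. g \<in> K \<longrightarrow> act (- g) y \<in> U \<longrightarrow> y \<in> V)"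
proof -
  have cont: "continuous_on UNIV (\<lambda>(g, x). act g x)"
    using continuous_action by (simp add: continuous_action_def)
  have swap: "continuous_on UNIV (prod.swap :: 'x \<times> 'g \<Rightarrow> _)"
    by (rule continuous_on_swap)
  have W: "open ((\<lambda>p. act (snd p) (fst p)) -` V)"
    using V(1) continuous_on_compose[OF swap continuous_on_subset[OF cont subset_UNIV]]
    by (intro open_vimage) (auto simp: o_def prod.swap_def case_prod_beta)
  have sub: "{x} \<times> K \<subseteq> (\<lambda>p. act (snd p) (fst p)) -` V"
    using V(2) by auto
  obtain U where U: "x \<in> U" "open U" "U \<times> K \<subseteq> (\<lambda>p. act (snd p) (fst p)) -` V"
    using Elementary_Topology.tube_lemma[OF K W sub] by blast
  have "y \<in> V" if "g \<in> K" "act (- g) y \<in> U" for g y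
    using U(3) that act_inverse(2)[of g y] by fastforce
  then show ?thesis
    using U by blast
qed

lemma cmod_inner2_integrated_le_of_compact_support:
  assumes T: "is_integrated_operator \<nu> (L2_0 \<nu>) (koopman act) \<mu> T"
    and S: "is_integrated_operator haar (L2 haar) left_regular \<mu> S"
    and \<mu>: "finite_measure \<mu>"
    and x: "x \<in> measure_support \<nu>" and K: "compact K"
    and null: "open_outer_measure \<nu> ((\<lambda>g. act g x) ` K) = 0"
    and f: "f \<in> L2 haar" "\<And>g. f g \<noteq> 0 \<Longrightarrow> g \<in> K"
    and h: "h \<in> L2 haar" "\<And>g. h g \<noteq> 0 \<Longrightarrow> g \<in> K"
  shows "cmod (inner2 haar (S f) h) \<le> operator_norm \<nu> (L2_0 \<nu>) T * (norm2 haar f * norm2 haar h)"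
proof -
  let ?m = "measure \<mu> (space \<mu>)" and ?n = "norm2 haar f * norm2 haar h"
  let ?N = "operator_norm \<nu> (L2_0 \<nu>) T"
  have "cmod (inner2 haar (S f) h) \<le> (?N + \<epsilon> * ?m) * ?n" if \<epsilon>: "\<epsilon> > 0" for \<epsilon>
  proof -
    have "(INF V\<in>{V. open V \<and> (\<lambda>g. act g x) ` K \<subseteq> V}. emeasure \<nu> V) < ennreal \<epsilon>"
      using null \<epsilon> by (simp add: open_outer_measure_def)
    then obtain V where V: "open V" "(\<lambda>g. act g x) ` K \<subseteq> V" "emeasure \<nu> V < ennreal \<epsilon>"
      unfolding INF_less_iff by blast
    obtain U where U: "open U" "x \<in> U" "\<And>g y. g \<in> K \<Longrightarrow> act (- g) y \<in> U \<Longrightarrow> y \<in> V"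
      using exists_neighbourhood_compact_translates[OF K V(1,2)] by blast
    have "emeasure \<nu> U > 0"
      using x U(1,2) by (auto simp: measure_support_def)
    then have pos: "prob U > 0"
      by (simp add: emeasure_eq_measure)
    have "cmod (inner2 haar (S f) h) \<le> (?N + prob V * ?m) * ?n"
    proof (rule cmod_inner2_integrated_le_of_small_support[OF T S \<mu> _ pos _ f(1) _ h(1)])
      show "U \<in> sets \<nu>" "V \<in> sets \<nu>"
        using U(1) V(1) by (simp_all add: sets_\<nu>)
    qed (use U(3) f(2) h(2) in blast)+
    also have "\<dots> \<le> (?N + \<epsilon> * ?m) * ?n"
      using V(3) \<epsilon> by (intro mult_right_mono add_left_mono) (auto simp: emeasure_eq_measure ennreal_less_iff)
    finally show ?thesis .
  qed
  then have "\<forall>\<^sub>F \<epsilon> in at_right 0. cmod (inner2 haar (S f) h) \<le> (?N + \<epsilon> * ?m) * ?n"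
    by (intro eventually_at_rightI[of 0 1]) auto
  moreover have "((\<lambda>\<epsilon>. (?N + \<epsilon> * ?m) * ?n) \<longlongrightarrow> (?N + 0 * ?m) * ?n) (at_right 0)"
    by (intro tendsto_intros)
  ultimately have "cmod (inner2 haar (S f) h) \<le> (?N + 0 * ?m) * ?n"
    by (intro tendsto_lowerbound) auto
  then show ?thesis
    by simp
qed

text \<open>
  Boundedness of \<open>S\<close>, with any constant, suffices to extend the estimate from compactly supported
  functions to all of \<open>L\<^sup>2\<close>.
\<close>
lemma cmod_inner2_integrated_le:
  assumes T: "is_integrated_operator \<nu> (L2_0 \<nu>) (koopman act) \<mu> T"
    and S: "is_integrated_operator haar (L2 haar) left_regular \<mu> S"
    and \<mu>: "finite_measure \<mu>"
    and x: "x \<in> measure_support \<nu>"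
    and null: "\<And>K. compact K \<Longrightarrow> open_outer_measure \<nu> ((\<lambda>g. act g x) ` K) = 0"
    and f: "f \<in> L2 haar" and h: "h \<in> L2 haar"
  shows "cmod (inner2 haar (S f) h) \<le> operator_norm \<nu> (L2_0 \<nu>) T * (norm2 haar f * norm2 haar h)"
proof -
  let ?N = "operator_norm \<nu> (L2_0 \<nu>) T"
  have Sb: "bounded_operator haar (L2 haar) S"
    using S by (simp add: is_integrated_operator_def)
  then obtain C where C: "\<And>\<xi>. \<xi> \<in> L2 haar \<Longrightarrow> norm2 haar (S \<xi>) \<le> C * norm2 haar \<xi>"
    unfolding bounded_operator_def by blast
  have regular: "outer_regular_on (sets borel) haar" "inner_regular_on {U. open U} haar"
    using haar by (auto simp: left_haar_measure_def)
  have N: "?N \<ge> 0"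
    using T by (intro operator_norm_nonneg zero_L2_0) (simp add: is_integrated_operator_def)
  have "cmod (inner2 haar (S f) h) \<le> ?N * (norm2 haar f * norm2 haar h) +
      \<bar>C\<bar> * \<delta> * (norm2 haar f + norm2 haar h)" if \<delta>: "\<delta> > 0" for \<delta>
  proof -
    obtain K1 where K1: "compact K1" "norm2 haar (\<lambda>g. indicator (- K1) g * f g) \<le> \<delta>"
      using L2_compact_approx[OF sets_haar regular f \<delta>] by blast
    obtain K2 where K2: "compact K2" "norm2 haar (\<lambda>g. indicator (- K2) g * h g) \<le> \<delta>"
      using L2_compact_approx[OF sets_haar regular h \<delta>] by blast
    define K where "K = K1 \<union> K2"
    have K: "compact K"
      using K1(1) K2(1) by (simp add: K_def compact_Un)
    have sets: "- K \<in> sets haar" "K \<in> sets haar" "- K1 \<in> sets haar" "- K2 \<in> sets haar"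
      using K K1(1) K2(1) by (auto simp: sets_haar dest!: compact_imp_closed)
    have small: "norm2 haar (\<lambda>g. indicator (- K) g * f g) \<le> \<delta>" "norm2 haar (\<lambda>g. indicator (- K) g * h g) \<le> \<delta>"
    proof -
      have "(\<lambda>g. indicator (- K) g * f g) = (\<lambda>g. indicator (- K) g * (indicator (- K1) g * f g))"
        "(\<lambda>g. indicator (- K) g * h g) = (\<lambda>g. indicator (- K) g * (indicator (- K2) g * h g))"
        by (auto simp: K_def indicator_def)
      then show "norm2 haar (\<lambda>g. indicator (- K) g * f g) \<le> \<delta>" "norm2 haar (\<lambda>g. indicator (- K) g * h g) \<le> \<delta>"
        using L2_restrict(2)[OF L2_restrict(1)[OF f sets(3)] sets(1)] K1(2)
          L2_restrict(2)[OF L2_restrict(1)[OF h sets(4)] sets(1)] K2(2) by auto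
    qed
    have "cmod (inner2 haar (S (\<lambda>g. indicator K g * f g)) (\<lambda>g. indicator K g * h g)) \<le>
        ?N * (norm2 haar (\<lambda>g. indicator K g * f g) * norm2 haar (\<lambda>g. indicator K g * h g))"
      using L2_restrict(1)[OF f sets(2)] L2_restrict(1)[OF h sets(2)]
      by (intro cmod_inner2_integrated_le_of_compact_support[OF T S \<mu> x K null[OF K]])
        (auto simp: indicator_def split: if_splits)
    also have "\<dots> \<le> ?N * (norm2 haar f * norm2 haar h)"
      by (intro mult_left_mono mult_mono L2_restrict(2) f h sets(2) N) auto
    finally show ?thesis
      using inner2_operator_restrict_approx[OF Sb C f h sets(2) small] by simp
  qed
  then have "\<forall>\<^sub>F \<delta> in at_right 0. cmod (inner2 haar (S f) h) \<le> ?N * (norm2 haar f * norm2 haar h) +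
      \<bar>C\<bar> * \<delta> * (norm2 haar f + norm2 haar h)"
    by (intro eventually_at_rightI[of 0 1]) auto
  moreover have "((\<lambda>\<delta>. ?N * (norm2 haar f * norm2 haar h) + \<bar>C\<bar> * \<delta> * (norm2 haar f + norm2 haar h)) \<longlongrightarrow>
      ?N * (norm2 haar f * norm2 haar h) + \<bar>C\<bar> * 0 * (norm2 haar f + norm2 haar h)) (at_right 0)"
    by (intro tendsto_intros)
  ultimately have "cmod (inner2 haar (S f) h) \<le>
      ?N * (norm2 haar f * norm2 haar h) + \<bar>C\<bar> * 0 * (norm2 haar f + norm2 haar h)"
    by (intro tendsto_lowerbound) auto
  then show ?thesis
    by simp
qed

end

theorem theorem1:
  fixes act :: "'g::{topological_group_add,t2_space} \<Rightarrow> 'x::topological_space \<Rightarrow> 'x"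
    and \<nu> :: "'x measure" and haar \<mu> :: "'g measure" and x\<^sub>0 :: 'x
    and T :: "('x \<Rightarrow> complex) \<Rightarrow> 'x \<Rightarrow> complex"
    and S :: "('g \<Rightarrow> complex) \<Rightarrow> 'g \<Rightarrow> complex"
  assumes "sets \<nu> = sets borel" and "prob_space \<nu>" and "atomless \<nu>"
    and "locally_compact_space (euclidean :: 'g topology)" and "unimodular TYPE('g)"
    and "continuous_action act" and "preserves_measure act \<nu>"
    and "strongly_continuous \<nu> (L2_0 \<nu>) (koopman act)"
    and "x\<^sub>0 \<in> measure_support \<nu>"
    and "\<And>K. compact K \<Longrightarrow> open_outer_measure \<nu> ((\<lambda>g. act g x\<^sub>0) ` K) = 0"
    and "compact (stabilizer act x\<^sub>0)"
    and "left_haar_measure haar"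
    and "finite_regular_borel_measure \<mu>"
    and "is_integrated_operator \<nu> (L2_0 \<nu>) (koopman act) \<mu> T"
    and "is_integrated_operator haar (L2 haar) left_regular \<mu> S"
  shows "operator_norm \<nu> (L2_0 \<nu>) T \<ge> operator_norm haar (L2 haar) S"
proof -
  interpret koopman_action \<nu> act haar
    using assms by (intro koopman_action.intro koopman_action_axioms.intro)
  let ?N = "operator_norm \<nu> (L2_0 \<nu>) T"
  have \<mu>: "finite_measure \<mu>"
    using assms(13) by (simp add: finite_regular_borel_measure_def)
  have N: "?N \<ge> 0"
    using assms(14) by (intro operator_norm_nonneg zero_L2_0) (simp add: is_integrated_operator_def)
  have "norm2 haar (S f) \<le> ?N" if f: "f \<in> L2 haar" "norm2 haar f \<le> 1" for f
  proof (cases "norm2 haar (S f) = 0")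
    case False
    then have pos: "norm2 haar (S f) > 0"
      using norm2_nonneg[of haar "S f"] by linarith
    have Sf: "S f \<in> L2 haar"
      using assms(15) f(1) by (simp add: is_integrated_operator_def bounded_operator_def)
    have "(norm2 haar (S f))\<^sup>2 = cmod (inner2 haar (S f) (S f))"
      by (simp add: inner2_self norm_power)
    also have "\<dots> \<le> ?N * (norm2 haar f * norm2 haar (S f))"
      by (rule cmod_inner2_integrated_le[OF assms(14,15) \<mu> assms(9,10) f(1) Sf])
    also have "\<dots> \<le> ?N * (1 * norm2 haar (S f))"
      by (intro mult_left_mono mult_right_mono f(2) N) simp
    finally show ?thesis
      using pos by (simp add: power2_eq_square)
  qed (use N in simp)
  moreover have "{f \<in> L2 haar. norm2 haar f \<le> 1} \<noteq> {}"
    using zero_L2_0[of haar] L2_0_subset_L2[of haar]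
    by (auto simp: norm2_def intro!: exI[of _ "\<lambda>x. 0"])
  ultimately show ?thesis
    unfolding operator_norm_def[of haar] by (intro cSUP_least) auto
qed

end
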